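(* Let $\{f_\theta(x,y):\theta\in\Theta\}$, where $\Theta\subset\mathbb{R}^d$, be a family of densities with respect to a $\sigma$-finite measure $\mu\times\nu$ on $\mathcal{X}\times\mathcal{Y}$. Let $X_1,X_2,\ldots$ be i.i.d. from a probability distribution $P$ that has a density $h$ with respect to $\mu$, and let $Y_1,Y_2,\ldots$ be i.i.d. from a probability distribution $Q$ that has a density $g$ with respect to $\nu$, the sequence $(X_i)$ being independent of the sequence $(Y_j)$. Suppose: (1) $\Theta$ is a second countable topological space; (2) for each $(x,y)$, the function $\theta\mapsto f_\theta(x,y)$ is upper semicontinuous on $\Theta$; (3) for each $\theta$, there exists a neighborhood $B_\theta$ of $\theta$ such that $$Q\log\Big[P\sup_{\phi\in B_\theta} f_\phi(X,Y)/\big(h(X)g(Y)\big)\Big]<\infty;$$ (4) for each $\theta$, there exists a neighborhood $C_\theta$ of $\theta$ such that for any subset $B$ of $C_\theta$, the family of functions $\{\sup_{\phi\in B} f_\phi(\cdot,y)/(h(\cdot)g(y)) : y\in\mathcal{Y}\}$ is $P$-Glivenko–Cantelli; (5) for each $\theta$, the family of functions $\{f_\theta(\cdot\mid y)/h(\cdot):y\in\mathcal{Y}\}$ is $P$-Glivenko–Cantelli. Then, with probability one, $K_{m,n}$ epi-converges to $K$ as $m,n\to\infty$.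
   Context: Notation. $P$ and $Q$ also denote expectation operators: $P$ integrates over $X\sim P$ (with everything else held fixed) and $Q$ integrates over $Y\sim Q$. $\mathbb{P}_m$ is the empirical measure of $X_1,\ldots,X_m$ and $\mathbb{Q}_n$ the empirical measure of $Y_1,\ldots,Y_n$, also used as expectation operators, e.g. $\mathbb{P}_m f(X)=\frac1m\sum_{i=1}^m f(X_i)$. Marginal and conditional densities: $f_\theta(y)=\int f_\theta(x,y)\,d\mu(x)$ and $f_\theta(x\mid y)=f_\theta(x,y)/f_\theta(y)$. The importance sampling density $h$ is such that $P f_\theta(X,y)/h(X)=f_\theta(y)$ for each $\theta$ and $y$. Put $f_{\theta,m}(y)=\mathbb{P}_m f_\theta(X,y)/h(X)=\frac1m\sum_{i=1}^m f_\theta(X_i,y)/h(X_i)$. Define $$K(\theta)=Q\log\frac{g(Y)}{f_\theta(Y)}\in[0,\infty],\qquad K_{m,n}(\theta)=\mathbb{Q}_n\log\frac{g(Y)}{f_{\theta,m}(Y)}.$$ It is assumed that $K$ is not identically $+\infty$ (the minimum value $K(\theta^* )$ of $K$ is finite). A family $\mathcal{F}$ of real functions on $\mathcal{X}$ is $P$-Glivenko–Cantelli if $\sup_{f\in\mathcal{F}}|\mathbb{P}_m f-Pf|\to0$ outer almost surely as $m\to\infty$. Epi-convergence of $K_{m,n}$ to $K$ as $m,n\to\infty$ means: for every sequence $(m_k,n_k)$ with $m_k\to\infty$ and $n_k\to\infty$, and every $\theta\in\Theta$, $$\sup_{B\in\mathcal{N}(\theta)}\limsup_{k\to\infty}\inf_{\phi\in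 B}K_{m_k,n_k}(\phi)\le K(\theta)\le\sup_{B\in\mathcal{N}(\theta)}\liminf_{k\to\infty}\inf_{\phi\in B}K_{m_k,n_k}(\phi),$$ where $\mathcal{N}(\theta)$ is the set of neighborhoods of $\theta$ in $\Theta$.
   Formalization: Added hypothesis: each θ has arbitrarily small neighborhoods V for which (x,y) ↦ sup_{φ∈V} f_φ(x,y) is jointly measurable; without some such measurability condition the statement fails for pathological (nonmeasurable) parameter sets. *)

theory Defs
  imports "HOL-Probability.Probability"
begin

definition nbhds_of :: "'t topology \<Rightarrow> 't \<Rightarrow> 't set set" where
  "nbhds_of T \<theta> = {B. B \<subseteq> topspace T \<and> (\<exists>U. openin T U \<and> \<theta> \<in> U \<and> U \<subseteq> B)}"

definition usc_map :: "'t topology \<Rightarrow> ('t \<Rightarrow> real) \<Rightarrow> bool" where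
  "usc_map T u \<longleftrightarrow> (\<forall>c. openin T {\<theta> \<in> topspace T. u \<theta> < c})"

definition epi_converges ::
  "'t topology \<Rightarrow> (nat \<Rightarrow> nat \<Rightarrow> 't \<Rightarrow> ereal) \<Rightarrow> ('t \<Rightarrow> ereal) \<Rightarrow> bool" where
  "epi_converges T F L \<longleftrightarrow>
    (\<forall>m n :: nat \<Rightarrow> nat. filterlim m at_top sequentially \<longrightarrow> filterlim n at_top sequentially \<longrightarrow>
      (\<forall>\<theta> \<in> topspace T.
        (SUP B \<in> nbhds_of T \<theta>. limsup (\<lambda>k. INF \<phi> \<in> B. F (m k) (n k) \<phi>)) \<le> L \<theta> \<and>
        L \<theta> \<le> (SUP B \<in> nbhds_of T \<theta>. liminf (\<lambda>k. INF \<phi> \<in> B. F (m k) (n k) \<phi>))))"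

definition ext_ln :: "ennreal \<Rightarrow> ereal" where
  "ext_ln a = (if a = 0 then -\<infinity> else if a = \<infinity> then \<infinity> else ereal (ln (enn2real a)))"

(* Expectation of an extended-real function as positive part minus negative part.  Since
   \<infinity> - \<infinity> = \<infinity> in ereal, "ext_expectation Q u < \<infinity>" says precisely that the positive part of u
   has a finite integral. *)
definition ext_expectation :: "'a measure \<Rightarrow> ('a \<Rightarrow> ereal) \<Rightarrow> ereal" where
  "ext_expectation Q u =
    enn2ereal (\<integral>\<^sup>+ y. e2ennreal (u y) \<partial>Q) - enn2ereal (\<integral>\<^sup>+ y. e2ennreal (- u y) \<partial>Q)"

(* Samples are indexed from 0: the first m observations are X 0, ..., X (m - 1).
   AE asserts that the set where convergence fails is contained in a measurable null set, i.e. has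
   outer probability zero; no measurability of the supremum is required. *)
definition glivenko_cantelli ::
  "'w measure \<Rightarrow> (nat \<Rightarrow> 'w \<Rightarrow> 'x) \<Rightarrow> 'x measure \<Rightarrow> ('x \<Rightarrow> real) set \<Rightarrow> bool" where
  "glivenko_cantelli M X P F \<longleftrightarrow>
    (\<forall>u \<in> F. integrable P u) \<and>
    (AE \<omega> in M. (\<lambda>m. SUP u \<in> F. ennreal \<bar>(\<Sum>i<m. u (X i \<omega>)) / real m - (\<integral>x. u x \<partial>P)\<bar>)
       \<longlonglongrightarrow> 0)"

definition marginal :: "'x measure \<Rightarrow> ('t \<Rightarrow> 'x \<Rightarrow> 'y \<Rightarrow> real) \<Rightarrow> 't \<Rightarrow> 'y \<Rightarrow> ennreal" where
  "marginal \<mu> f \<theta> y = (\<integral>\<^sup>+ x. ennreal (f \<theta> x y) \<partial>\<mu>)"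

(* Division by zero in the reals makes this the zero function of x when the marginal at y is 0
   or \<infinity>, where the conditional density is undefined. *)
definition conditional :: "'x measure \<Rightarrow> ('t \<Rightarrow> 'x \<Rightarrow> 'y \<Rightarrow> real) \<Rightarrow> 't \<Rightarrow> 'x \<Rightarrow> 'y \<Rightarrow> real" where
  "conditional \<mu> f \<theta> x y = f \<theta> x y / enn2real (marginal \<mu> f \<theta> y)"

definition mc_marginal ::
  "('x \<Rightarrow> real) \<Rightarrow> ('t \<Rightarrow> 'x \<Rightarrow> 'y \<Rightarrow> real) \<Rightarrow> (nat \<Rightarrow> 'x) \<Rightarrow> nat \<Rightarrow> 't \<Rightarrow> 'y \<Rightarrow> real" where
  "mc_marginal h f xs m \<theta> y = (\<Sum>i<m. f \<theta> (xs i) y / h (xs i)) / real m"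

definition KL ::
  "'x measure \<Rightarrow> 'y measure \<Rightarrow> ('y \<Rightarrow> real) \<Rightarrow> ('t \<Rightarrow> 'x \<Rightarrow> 'y \<Rightarrow> real) \<Rightarrow> 't \<Rightarrow> ereal" where
  "KL \<mu> Q g f \<theta> = ext_expectation Q (\<lambda>y. ext_ln (ennreal (g y) / marginal \<mu> f \<theta> y))"

definition KL_mc ::
  "('x \<Rightarrow> real) \<Rightarrow> ('y \<Rightarrow> real) \<Rightarrow> ('t \<Rightarrow> 'x \<Rightarrow> 'y \<Rightarrow> real) \<Rightarrow> (nat \<Rightarrow> 'x) \<Rightarrow> (nat \<Rightarrow> 'y)
    \<Rightarrow> nat \<Rightarrow> nat \<Rightarrow> 't \<Rightarrow> ereal" where
  "KL_mc h g f xs ys m n \<theta> =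
    (\<Sum>j<n. ext_ln (ennreal (g (ys j)) / ennreal (mc_marginal h f xs m \<theta> (ys j)))) / ereal (real n)"

(* Used where suprema may be infinite or must be integrated jointly in x and y. *)
definition sup_density :: "('t \<Rightarrow> 'x \<Rightarrow> 'y \<Rightarrow> real) \<Rightarrow> 't set \<Rightarrow> 'x \<Rightarrow> 'y \<Rightarrow> ennreal" where
  "sup_density f B x y = (SUP \<phi> \<in> B. ennreal (f \<phi> x y))"

(* Real-valued; meaningful when B is nonempty and the supremum is finite.  Where h x = 0 or g y = 0
   the quotient is undefined and takes the value 0: the first happens on a P-null set of x only, and
   for y with g y = 0 one obtains the zero function, which does not affect the Glivenko-Cantelli
   property of the family. *)
definition sup_ratio ::
  "('x \<Rightarrow> real) \<Rightarrow> ('y \<Rightarrow> real) \<Rightarrow> ('t \<Rightarrow> 'x \<Rightarrow> 'y \<Rightarrow> real) \<Rightarrow> 't set \<Rightarrow> 'y \<Rightarrow> 'x \<Rightarrow> real" where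
  "sup_ratio h g f B y x = (SUP \<phi> \<in> B. f \<phi> x y) / (h x * g y)"

end

theory Submission
  imports Defs
begin

text \<open>
  Epi-convergence consists of two one-sided bounds, each of which must hold outside a single null
  set for all parameters and for all ways in which \<open>m\<close> and \<open>n\<close> tend to infinity.  Second
  countability reduces the parameters to countable families, and the Glivenko-Cantelli hypotheses
  make the Monte Carlo error uniform in \<open>y\<close>, so that the joint limit splits into a uniform limit in
  \<open>m\<close> and a strong law of large numbers in \<open>n\<close>.

  Upper bound.  For a fixed \<open>\<theta>\<close> with finite divergence, \<open>K\<^sub>m\<^sub>,\<^sub>n(\<theta>)\<close> is the empirical mean of
  \<open>ln (g / f\<^sub>\<theta>)\<close> over the \<open>Y j\<close>, minus the empirical mean of \<open>ln (f\<^sub>\<theta>\<^sub>,\<^sub>m / f\<^sub>\<theta>)\<close>.  The first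
  converges to \<open>K(\<theta>)\<close> by the strong law.  The second tends to zero because \<open>f\<^sub>\<theta>\<^sub>,\<^sub>m / f\<^sub>\<theta>\<close> tends to
  one uniformly (\<open>AE_limsup_KL_mc_le\<close>).  It is enough to know this for the \<open>\<theta>\<close> in a countable set on
  which the infimum of \<open>K\<close> over any open set is attained approximately (\<open>countable_INF_dense\<close>).

  Lower bound.  For a neighbourhood \<open>V\<close> let the envelope be the integral over \<open>x \<sim> P\<close> of the supremum
  over \<open>\<phi> \<in> V\<close> of \<open>f\<^sub>\<phi>(x, y) / (h(x) g(y))\<close>.  The infimum of \<open>K\<^sub>m\<^sub>,\<^sub>n\<close> over \<open>V\<close> is bounded
  below by the empirical mean of \<open>- ln\<close> of the Monte Carlo estimate of the envelope, and that estimate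
  is uniformly close to the envelope.  For every \<open>\<epsilon> > 0\<close> the lower limit is therefore at least the
  \<open>Q\<close>-integral of \<open>- ln (\<epsilon> + envelope)\<close> (\<open>AE_le_liminf_INF_KL_mc\<close>).  Letting \<open>V\<close> shrink to \<open>\<theta>\<close>
  and \<open>\<epsilon>\<close> tend to zero, upper semicontinuity, dominated convergence in \<open>x\<close> and Fatou's lemma in
  \<open>y\<close> bring this bound up to \<open>K(\<theta>)\<close> (\<open>KL_le_of_shrinking\<close>).  Only countably many \<open>V\<close> and \<open>\<epsilon>\<close>
  are involved (\<open>countable_neighbourhood_family\<close>).

  The strong law for integrable functions of an independent identically distributed sequence is
  obtained on the product space from a maximal ergodic argument
  (\<open>AE_bounded_partial_sums\<close>, \<open>strong_law_of_large_numbers\<close>).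
\<close>

section \<open>Countable families of neighbourhoods\<close>

text \<open>
  Almost sure statements can be combined over countably many parameters only.  A countable set
  that approximates the infimum of \<open>L\<close> over every open set is enough for the upper bound in
  epi-convergence, which concerns infima over neighbourhoods; \<open>L\<close> may be arbitrary, and density of
  the set in the topological sense would not suffice.
\<close>

lemma countable_INF_dense:
  fixes L :: "'a \<Rightarrow> ereal"
  assumes "second_countable T"
  obtains D where "countable D" "D \<subseteq> topspace T"
    "\<And>U \<theta>. openin T U \<Longrightarrow> \<theta> \<in> U \<Longrightarrow> (INF \<phi>\<in>D \<inter> U. L \<phi>) \<le> L \<theta>"
proof -
  obtain \<B> where \<B>: "countable \<B>" "\<And>V. V \<in> \<B> \<Longrightarrow> openin T V"
    "\<And>U x. openin T U \<Longrightarrow> x \<in> U \<Longrightarrow> \<exists>V\<in>\<B>. x \<in> V \<and> V \<subseteq> U"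
    using assms unfolding second_countable_def by metis
  \<comment> \<open>a minimizing sequence inside each of the countably many basic open sets\<close>
  have "\<exists>E. countable E \<and> E \<subseteq> B \<and> (INF \<phi>\<in>E. L \<phi>) \<le> (INF \<phi>\<in>B. L \<phi>)" for B
  proof (cases "B = {}")
    case False
    then obtain s :: "nat \<Rightarrow> ereal" where s: "range s \<subseteq> L ` B" "Inf (L ` B) = (INF i. s i)"
      using Inf_countable_INF[of "L ` B"] by auto
    then have "\<forall>i. \<exists>\<phi>\<in>B. s i = L \<phi>" by blast
    then obtain t where t: "\<And>i. t i \<in> B" "\<And>i. s i = L (t i)" by metis
    have "s = (\<lambda>i. L (t i))" using t(2) by blast
    then have "(INF \<phi>\<in>range t. L \<phi>) = (INF \<phi>\<in>B. L \<phi>)"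
      unfolding s(2) by (simp only: image_image)
    then show ?thesis using t(1) by (intro exI[of _ "range t"]) auto
  qed auto
  then obtain E where E: "\<And>B. countable (E B)" "\<And>B. E B \<subseteq> B"
      "\<And>B. (INF \<phi>\<in>E B. L \<phi>) \<le> (INF \<phi>\<in>B. L \<phi>)" by metis
  show ?thesis
  proof
    show "countable (\<Union>B\<in>\<B>. E B)" using \<B>(1) E(1) by blast
    show "(\<Union>B\<in>\<B>. E B) \<subseteq> topspace T" by (intro UN_least subset_trans[OF E(2)] openin_subset \<B>(2))
    fix U \<theta> assume "openin T U" "\<theta> \<in> U"
    then obtain B where B: "B \<in> \<B>" "\<theta> \<in> B" "B \<subseteq> U" using \<B>(3)[of U \<theta>] by blast
    have "(INF \<phi>\<in>(\<Union>B\<in>\<B>. E B) \<inter> U. L \<phi>) \<le> (INF \<phi>\<in>E B. L \<phi>)"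
      using B E(2)[of B] by (intro INF_superset_mono) auto
    also have "\<dots> \<le> L \<theta>" by (rule order_trans[OF E(3) INF_lower[OF B(2)]])
    finally show "(INF \<phi>\<in>(\<Union>B\<in>\<B>. E B) \<inter> U. L \<phi>) \<le> L \<theta>" .
  qed
qed

text \<open>
  For the lower bound the null sets have to be indexed by countably many neighbourhoods that
  nevertheless are small at every point and have the property \<open>R\<close>, here measurability of the
  supremum of the densities.  It is enough to pick one such set between \<open>A\<close> and \<open>B\<close> for every pair
  of basic open sets that admits one.
\<close>

lemma countable_neighbourhood_family:
  assumes "second_countable T" and R: "neighbourhood_base_of R T"
  obtains \<V> where "countable \<V>" "\<And>V. V \<in> \<V> \<Longrightarrow> R V"
    "\<And>U \<theta>. U \<in> nbhds_of T \<theta> \<Longrightarrow> \<exists>V\<in>\<V>. V \<in> nbhds_of T \<theta> \<and> V \<subseteq> U"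
proof -
  obtain \<B> where \<B>: "countable \<B>" "\<And>V. V \<in> \<B> \<Longrightarrow> openin T V"
    "\<And>U x. openin T U \<Longrightarrow> x \<in> U \<Longrightarrow> \<exists>V\<in>\<B>. x \<in> V \<and> V \<subseteq> U"
    using assms(1) unfolding second_countable_def by metis
  define I where "I = {(A, B). A \<in> \<B> \<and> B \<in> \<B> \<and> (\<exists>V. R V \<and> A \<subseteq> V \<and> V \<subseteq> B)}"
  have "I \<subseteq> \<B> \<times> \<B>" by (auto simp: I_def)
  then have "countable I" by (rule countable_subset) (use \<B>(1) in auto)
  have "\<forall>p\<in>I. \<exists>V. R V \<and> fst p \<subseteq> V \<and> V \<subseteq> snd p" by (auto simp: I_def)
  then obtain N where N: "\<And>p. p \<in> I \<Longrightarrow> R (N p) \<and> fst p \<subseteq> N p \<and> N p \<subseteq> snd p" by metis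
  show ?thesis
  proof
    show "countable (N ` I)" using \<open>countable I\<close> by blast
    show "R V" if "V \<in> N ` I" for V using that N by blast
    fix U \<theta> assume "U \<in> nbhds_of T \<theta>"
    then obtain U' where U': "openin T U'" "\<theta> \<in> U'" "U' \<subseteq> U" and U: "U \<subseteq> topspace T"
      unfolding nbhds_of_def by blast
    then obtain B where B: "B \<in> \<B>" "\<theta> \<in> B" "B \<subseteq> U'" using \<B>(3)[of U' \<theta>] by blast
    have "\<exists>W V. openin T W \<and> R V \<and> \<theta> \<in> W \<and> W \<subseteq> V \<and> V \<subseteq> B"
      using R B(2) \<B>(2)[OF B(1)] unfolding neighbourhood_base_of by blast
    then obtain W V where V: "openin T W" "R V" "\<theta> \<in> W" "W \<subseteq> V" "V \<subseteq> B" by blast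
    obtain A where A: "A \<in> \<B>" "\<theta> \<in> A" "A \<subseteq> W" using \<B>(3)[of W \<theta>] V by blast
    have "(A, B) \<in> I" using A B V unfolding I_def by blast
    have AN: "A \<subseteq> N (A, B)" and NU: "N (A, B) \<subseteq> U"
      using N[OF \<open>(A, B) \<in> I\<close>] B(3) U'(3) by auto
    have "N (A, B) \<subseteq> topspace T" using NU U by (rule order_trans)
    with AN A(2) \<B>(2)[OF A(1)] have "N (A, B) \<in> nbhds_of T \<theta>"
      unfolding nbhds_of_def by blast
    with NU \<open>(A, B) \<in> I\<close> show "\<exists>V\<in>N ` I. V \<in> nbhds_of T \<theta> \<and> V \<subseteq> U" by blast
  qed
qed

lemma shrinking_neighbourhoods:
  assumes T: "second_countable T" and U: "U \<in> nbhds_of T \<theta>"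
    and \<V>: "\<And>U. U \<in> nbhds_of T \<theta> \<Longrightarrow> \<exists>V\<in>\<V>. V \<in> nbhds_of T \<theta> \<and> V \<subseteq> U"
  obtains V :: "nat \<Rightarrow> 'a set" where "\<And>k. V k \<in> \<V>" "\<And>k. V k \<in> nbhds_of T \<theta>" "\<And>k. V k \<subseteq> U"
    "\<And>W. openin T W \<Longrightarrow> \<theta> \<in> W \<Longrightarrow> \<forall>\<^sub>F k in sequentially. V k \<subseteq> W"
proof -
  obtain \<B> where \<B>: "countable \<B>" "\<And>V. V \<in> \<B> \<Longrightarrow> openin T V"
    "\<And>U x. openin T U \<Longrightarrow> x \<in> U \<Longrightarrow> \<exists>V\<in>\<B>. x \<in> V \<and> V \<subseteq> U"
    using T unfolding second_countable_def by metis
  define \<B>' where "\<B>' = {B \<in> \<B>. \<theta> \<in> B}"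
  have \<theta>: "\<theta> \<in> topspace T" using U unfolding nbhds_of_def by blast
  then have ne: "\<B>' \<noteq> {}" and co: "countable \<B>'"
    using \<B>(1) \<B>(3)[OF openin_topspace \<theta>] by (auto simp: \<B>'_def)
  define b where "b = from_nat_into \<B>'"
  have b: "b k \<in> \<B>'" "openin T (b k)" "\<theta> \<in> b k" for k
    using from_nat_into[OF ne, of k] \<B>(2) by (auto simp: b_def \<B>'_def)
  have "U \<inter> (\<Inter>i\<le>k. b i) \<in> nbhds_of T \<theta>" for k
  proof -
    obtain U' where U': "openin T U'" "\<theta> \<in> U'" "U' \<subseteq> U"
      using U unfolding nbhds_of_def by blast
    have "openin T (U' \<inter> (\<Inter>i\<le>k. b i))"
      using U'(1) b(2) by (intro openin_Int openin_INT) auto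
    then show ?thesis using U U' b(3) unfolding nbhds_of_def
      by (auto intro!: exI[of _ "U' \<inter> (\<Inter>i\<le>k. b i)"])
  qed
  from \<V>[OF this] have "\<forall>k. \<exists>V. V \<in> \<V> \<and> V \<in> nbhds_of T \<theta> \<and> V \<subseteq> U \<inter> (\<Inter>i\<le>k. b i)"
    by blast
  then obtain V where V: "\<And>k. V k \<in> \<V> \<and> V k \<in> nbhds_of T \<theta> \<and> V k \<subseteq> U \<inter> (\<Inter>i\<le>k. b i)"
    by metis
  show ?thesis
  proof
    fix W assume "openin T W" "\<theta> \<in> W"
    then obtain B where B: "B \<in> \<B>'" "B \<subseteq> W" using \<B>(3)[of W \<theta>] unfolding \<B>'_def by blast
    then obtain i where i: "B = b i" unfolding b_def using from_nat_into_surj[OF co] by metis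
    show "\<forall>\<^sub>F k in sequentially. V k \<subseteq> W"
      using eventually_ge_at_top[of i]
    proof eventually_elim
      case (elim k)
      then have "V k \<subseteq> b i" using V[of k] by blast
      then show ?case using B i by blast
    qed
  qed (use V in auto)
qed

lemma nbhds_of_memD: "U \<in> nbhds_of T \<theta> \<Longrightarrow> \<theta> \<in> U"
  unfolding nbhds_of_def by blast

lemma nbhds_of_Int: "U \<in> nbhds_of T \<theta> \<Longrightarrow> V \<in> nbhds_of T \<theta> \<Longrightarrow> U \<inter> V \<in> nbhds_of T \<theta>"
  unfolding nbhds_of_def by (blast intro: openin_Int)

text \<open>
  The upper half of epi-convergence follows from an upper bound at each point of a set \<open>D\<close> as
  constructed above: the infimum over a neighbourhood is at most the value at any point of \<open>D\<close> in it.
\<close>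

lemma epi_limsup_le:
  assumes D: "\<And>U \<theta>. openin T U \<Longrightarrow> \<theta> \<in> U \<Longrightarrow> (INF \<phi>\<in>D \<inter> U. L \<phi>) \<le> L \<theta>"
    and lim: "\<And>\<phi>. \<phi> \<in> D \<Longrightarrow> limsup (\<lambda>k. F k \<phi>) \<le> (L \<phi> :: ereal)"
  shows "(SUP B \<in> nbhds_of T \<theta>. limsup (\<lambda>k. INF \<phi> \<in> B. F k \<phi>)) \<le> L \<theta>"
proof (rule SUP_least)
  fix B assume "B \<in> nbhds_of T \<theta>"
  then obtain U where U: "openin T U" "\<theta> \<in> U" "U \<subseteq> B" unfolding nbhds_of_def by blast
  have "limsup (\<lambda>k. INF \<phi> \<in> B. F k \<phi>) \<le> (INF \<phi>\<in>D \<inter> U. L \<phi>)"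
  proof (rule INF_greatest)
    fix \<phi> assume \<phi>: "\<phi> \<in> D \<inter> U"
    have "limsup (\<lambda>k. INF \<phi> \<in> B. F k \<phi>) \<le> limsup (\<lambda>k. F k \<phi>)"
      using \<phi> U by (intro Limsup_mono always_eventually allI INF_lower) auto
    also have "\<dots> \<le> L \<phi>" using \<phi> lim by auto
    finally show "limsup (\<lambda>k. INF \<phi> \<in> B. F k \<phi>) \<le> L \<phi>" .
  qed
  also have "\<dots> \<le> L \<theta>" using D U by blast
  finally show "limsup (\<lambda>k. INF \<phi> \<in> B. F k \<phi>) \<le> L \<theta>" .
qed

section \<open>Extended logarithm and expectation\<close>

lemma ext_ln_ennreal: "0 < r \<Longrightarrow> ext_ln (ennreal r) = ereal (ln r)"
  by (simp add: ext_ln_def)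

lemma ext_ln_mono: "a \<le> b \<Longrightarrow> ext_ln a \<le> ext_ln b"
proof (cases a; cases b)
  fix r s :: real assume "a \<le> b" "0 \<le> r" "0 \<le> s" "a = ennreal r" "b = ennreal s"
  then show ?thesis by (auto simp: ext_ln_def)
qed (auto simp: ext_ln_def top_unique)

lemma ext_ln_divide_swap:
  assumes "0 < r"
  shows "ext_ln (ennreal r / a) = - ext_ln (a / ennreal r)"
proof (cases a)
  case (real s)
  show ?thesis
  proof (cases "s = 0")
    case True
    then show ?thesis using assms real by (simp add: ext_ln_def ennreal_divide_eq_top_iff)
  next
    case False
    then have "0 < s" using real by simp
    then show ?thesis using assms real by (simp add: divide_ennreal ext_ln_ennreal ln_div)
  qed
next
  case top
  then show ?thesis using assms by (simp add: ext_ln_def ennreal_top_divide)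
qed

lemma measurable_ext_ln [measurable]: "ext_ln \<in> borel_measurable borel"
  unfolding ext_ln_def[abs_def] by measurable

lemma ext_expectation_eq_integral:
  assumes w: "integrable Q w" and u: "AE y in Q. u y = ereal (w y)"
  shows "ext_expectation Q u = ereal (\<integral>y. w y \<partial>Q)"
proof -
  have 1: "(\<integral>\<^sup>+y. e2ennreal (u y) \<partial>Q) = (\<integral>\<^sup>+y. ennreal (w y) \<partial>Q)"
    by (rule nn_integral_cong_AE) (use u in eventually_elim, simp add: e2ennreal_ereal)
  have 2: "(\<integral>\<^sup>+y. e2ennreal (- u y) \<partial>Q) = (\<integral>\<^sup>+y. ennreal (- w y) \<partial>Q)"
    by (rule nn_integral_cong_AE) (use u in eventually_elim, simp add: e2ennreal_ereal)
  have fin: "(\<integral>\<^sup>+y. ennreal (w y) \<partial>Q) \<noteq> \<infinity>" "(\<integral>\<^sup>+y. ennreal (- w y) \<partial>Q) \<noteq> \<infinity>"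
    using w unfolding real_integrable_def by auto
  then obtain a b where ab: "0 \<le> a" "0 \<le> b" "(\<integral>\<^sup>+y. ennreal (w y) \<partial>Q) = ennreal a"
      "(\<integral>\<^sup>+y. ennreal (- w y) \<partial>Q) = ennreal b"
    by (metis ennreal_cases infinity_ennreal_def)
  have "(\<integral>y. w y \<partial>Q) = a - b"
    using real_lebesgue_integral_def[OF w] ab by simp
  then show ?thesis unfolding ext_expectation_def 1 2 ab using ab(1,2) by (simp add: enn2ereal_ennreal)
qed

lemma ext_expectation_less_topD:
  assumes "ext_expectation Q u < \<infinity>"
  shows "(\<integral>\<^sup>+ y. e2ennreal (u y) \<partial>Q) < \<infinity>"
proof (rule ccontr)
  assume "\<not> ?thesis"
  then have "(\<integral>\<^sup>+ y. e2ennreal (u y) \<partial>Q) = \<infinity>" by (simp add: not_less top_unique)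
  then show False using assms unfolding ext_expectation_def by simp
qed

text \<open>
  An extended-real integrand whose positive and negative parts both have finite integrals is almost
  everywhere real, so its expectation is an ordinary integral and the law of large numbers applies.
\<close>

lemma ext_expectation_finite:
  assumes u [measurable]: "u \<in> borel_measurable Q"
    and pos: "ext_expectation Q u < \<infinity>" and neg: "(\<integral>\<^sup>+ y. e2ennreal (- u y) \<partial>Q) < \<infinity>"
  shows "AE y in Q. \<bar>u y\<bar> \<noteq> \<infinity>" and "integrable Q (\<lambda>y. real_of_ereal (u y))"
    and "ext_expectation Q u = ereal (\<integral>y. real_of_ereal (u y) \<partial>Q)"
proof -
  note pos' = ext_expectation_less_topD[OF pos]
  have "AE y in Q. e2ennreal (u y) \<noteq> \<infinity>" "AE y in Q. e2ennreal (- u y) \<noteq> \<infinity>"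
    using pos' neg by (intro nn_integral_PInf_AE; simp)+
  then show fin: "AE y in Q. \<bar>u y\<bar> \<noteq> \<infinity>"
  proof eventually_elim
    case (elim y)
    then show ?case by (cases "u y") auto
  qed
  then have eq: "AE y in Q. u y = ereal (real_of_ereal (u y))"
    by eventually_elim (simp add: ereal_real)
  have 1: "(\<integral>\<^sup>+y. ennreal (real_of_ereal (u y)) \<partial>Q) = (\<integral>\<^sup>+y. e2ennreal (u y) \<partial>Q)"
    by (rule nn_integral_cong_AE) (use eq in eventually_elim, metis e2ennreal_ereal)
  have 2: "(\<integral>\<^sup>+y. ennreal (- real_of_ereal (u y)) \<partial>Q) = (\<integral>\<^sup>+y. e2ennreal (- u y) \<partial>Q)"
    by (rule nn_integral_cong_AE) (use eq in eventually_elim, metis e2ennreal_ereal uminus_ereal.simps(1))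
  show int: "integrable Q (\<lambda>y. real_of_ereal (u y))"
    unfolding real_integrable_def 1 2 using pos' neg by auto
  show "ext_expectation Q u = ereal (\<integral>y. real_of_ereal (u y) \<partial>Q)"
    by (rule ext_expectation_eq_integral[OF int eq])
qed

text \<open>
  The inequality \<open>ln z \<le> z\<close>.  With \<open>z = f\<^sub>\<theta>(y) / g(y)\<close> it bounds the negative part of the
  Kullback-Leibler integrand by a function whose integral is at most one.
\<close>

lemma e2ennreal_uminus_ext_ln_le:
  assumes "0 < r"
  shows "e2ennreal (- ext_ln (ennreal r / a)) \<le> a / ennreal r"
proof (cases a)
  case (real s)
  show ?thesis
  proof (cases "s = 0")
    case True
    then show ?thesis using assms real by (simp add: ext_ln_def ennreal_divide_eq_top_iff e2ennreal_neg)
  next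
    case False
    then have s: "0 < s" using real by simp
    have "ln (s / r) \<le> s / r" using s assms ln_le_minus_one[of "s / r"] by simp
    then have "- ln (r / s) \<le> s / r" using s assms by (simp add: ln_div)
    then show ?thesis using assms s real
      by (simp add: divide_ennreal ext_ln_ennreal e2ennreal_ereal ennreal_leI)
  qed
next
  case top
  then show ?thesis using assms by (simp add: ennreal_top_divide)
qed

section \<open>The strong law of large numbers\<close>

text \<open>
  The maximum of the partial sums of \<open>u (w 0), u (w 1), \<dots>\<close> with at most \<open>n\<close> terms, the
  empty sum included.  The recursion through the shifted sequence is the identity that drives the
  maximal ergodic argument below.
\<close>

primrec running_max :: "('a \<Rightarrow> real) \<Rightarrow> nat \<Rightarrow> (nat \<Rightarrow> 'a) \<Rightarrow> real" where
  "running_max u 0 w = 0"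
| "running_max u (Suc n) w = max 0 (u (w 0) + running_max u n (\<lambda>i. w (Suc i)))"

lemma running_max_nonneg: "0 \<le> running_max u n w"
  by (cases n) auto

lemma sum_le_running_max: "(\<Sum>i<n. u (w i)) \<le> running_max u n w"
proof (induction n arbitrary: w)
  case (Suc n)
  have "(\<Sum>i<Suc n. u (w i)) = u (w 0) + (\<Sum>i<n. u (w (Suc i)))"
    by (rule sum.lessThan_Suc_shift)
  with Suc[of "\<lambda>i. w (Suc i)"] show ?case by simp
qed simp

lemma running_max_Suc_mono: "running_max u n w \<le> running_max u (Suc n) w"
proof (induction n arbitrary: w)
  case (Suc n)
  from Suc[of "\<lambda>i. w (Suc i)"] show ?case by simp
qed simp

lemma running_max_mono: "m \<le> n \<Longrightarrow> running_max u m w \<le> running_max u n w"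
  by (rule lift_Suc_mono_le[of "\<lambda>n. running_max u n w"]) (rule running_max_Suc_mono)

lemma running_max_le_sum_abs: "running_max u n w \<le> (\<Sum>i<n. \<bar>u (w i)\<bar>)"
proof (induction n arbitrary: w)
  case (Suc n)
  have "(\<Sum>i<Suc n. \<bar>u (w i)\<bar>) = \<bar>u (w 0)\<bar> + (\<Sum>i<n. \<bar>u (w (Suc i))\<bar>)"
    by (rule sum.lessThan_Suc_shift)
  with Suc[of "\<lambda>i. w (Suc i)"] running_max_nonneg[of u n "\<lambda>i. w (Suc i)"] show ?case
    by simp
qed simp

lemma measurable_running_max [measurable]:
  assumes [measurable]: "u \<in> borel_measurable Q"
  shows "running_max u n \<in> borel_measurable (PiM UNIV (\<lambda>_. Q))"
proof (induction n)
  case (Suc n)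
  have [measurable]: "(\<lambda>w i. w (Suc i)) \<in> measurable (PiM UNIV (\<lambda>_. Q)) (PiM UNIV (\<lambda>_. Q))"
    by (rule measurable_PiM_single') (auto simp: space_PiM PiE_iff)
  note Suc[measurable]
  show ?case by simp
qed simp

lemma (in sequence_space) integrable_coordinate:
  assumes "integrable M u"
  shows "integrable S (\<lambda>w. u (w i) :: real)"
proof -
  have "distr S M (\<lambda>w. w i) = M" by (rule PiM_component) simp
  with assms have "integrable (distr S M (\<lambda>w. w i)) u" by simp
  then show ?thesis by (subst (asm) integrable_distr_eq) (use assms in auto)
qed

lemma (in sequence_space) integrable_running_max:
  assumes u: "integrable M u"
  shows "integrable S (running_max u n)"
proof (rule Bochner_Integration.integrable_bound)
  show "integrable S (\<lambda>w. \<Sum>i<n. \<bar>u (w i)\<bar>)"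
    using integrable_coordinate[OF u] by auto
  show "running_max u n \<in> borel_measurable S" using u by auto
  show "AE w in S. norm (running_max u n w) \<le> norm (\<Sum>i<n. \<bar>u (w i)\<bar>)"
    using running_max_le_sum_abs[of u n] running_max_nonneg[of u n]
    by (auto simp: abs_of_nonneg sum_nonneg)
qed

text \<open>
  Negative drift keeps the partial sums bounded above.  Let \<open>U\<close> be the event that they are not, and
  \<open>R n\<close> the running maximum.  Prefixing a sequence \<open>w\<close> with an independent first coordinate \<open>x\<close>
  preserves the distribution and does not change membership in \<open>U\<close>, and
  \<open>R (n + 1) - R n\<close> integrates over \<open>U\<close> to something nonnegative.  After the prefixing this integral
  becomes the integral over \<open>w \<in> U\<close> of \<open>max 0 (u x + R n w) - R n w = max (- R n w) (u x)\<close>.  On \<open>U\<close>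
  the running maximum tends to infinity, so the limit is the integral of \<open>u x\<close> over \<open>w \<in> U\<close>, which by
  independence is the mean of \<open>u\<close> times the probability of \<open>U\<close>.  As the mean is negative and the
  limit is not, \<open>U\<close> has probability zero.
\<close>

lemma (in sequence_space) AE_bounded_partial_sums:
  assumes u: "integrable M u" and neg: "(\<integral>x. u x \<partial>M) < 0"
  shows "AE w in S. \<exists>c::real. \<forall>n. (\<Sum>i<n. u (w i)) \<le> c"
proof -
  let ?R = "running_max u"
  define U where "U = (\<lambda>w. \<forall>c::nat. \<exists>n. real c < ?R n w)"
  have um [measurable]: "u \<in> borel_measurable M" using u by auto
  have U_meas [measurable]: "Measurable.pred S U" unfolding U_def by measurable
  define A where "A = (\<lambda>w. of_bool (U w) :: real)"
  have A_meas [measurable]: "A \<in> borel_measurable S" unfolding A_def by measurable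
  have A01: "0 \<le> A w" "A w \<le> 1" for w by (auto simp: A_def)
  have shift_meas [measurable]:
    "(\<lambda>(x, w). case_nat x w) \<in> measurable (M \<Otimes>\<^sub>M S) S" by measurable
  have R_shift: "?R (Suc n) (case_nat x w) = max 0 (u x + ?R n w)" for n x w
    by simp
  have U_shift: "U (case_nat x w) \<longleftrightarrow> U w" for x w
  proof
    assume *: "U (case_nat x w)"
    show "U w" unfolding U_def
    proof
      fix c :: nat
      obtain b :: nat where b: "real c + \<bar>u x\<bar> < real b" using reals_Archimedean2 by blast
      obtain n where n: "real b < ?R n (case_nat x w)" using * unfolding U_def by blast
      have "real b < ?R (Suc n) (case_nat x w)"
        using n running_max_Suc_mono[of u n "case_nat x w"] by linarith
      then show "\<exists>n. real c < ?R n w" unfolding R_shift using b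
        by (intro exI[of _ n]) (auto simp: max_def split: if_splits)
    qed
  next
    assume *: "U w"
    show "U (case_nat x w)" unfolding U_def
    proof
      fix c :: nat
      obtain b :: nat where b: "real c + \<bar>u x\<bar> < real b" using reals_Archimedean2 by blast
      obtain n where n: "real b < ?R n w" using * unfolding U_def by blast
      then have "real c < ?R (Suc n) (case_nat x w)" unfolding R_shift using b by auto
      then show "\<exists>n. real c < ?R n (case_nat x w)" by blast
    qed
  qed
  have A_shift: "A (case_nat x w) = A w" for x w by (simp add: A_def U_shift)
  interpret MS: pair_prob_space M S by standard
  have int_fst: "integrable (M \<Otimes>\<^sub>M S) (\<lambda>(x, w). u x)"
    using P.distr_pair_fst[of M] integrable_distr_eq[of fst "M \<Otimes>\<^sub>M S" M u] u
    by (simp add: case_prod_beta')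
  have int_Au: "integrable (M \<Otimes>\<^sub>M S) (\<lambda>(x, w). A w * u x)"
    by (rule Bochner_Integration.integrable_bound[OF int_fst])
       (auto simp: abs_mult A01 mult_left_le_one_le case_prod_beta')
  have int_AR: "integrable S (\<lambda>w. A w * ?R n w)" for n
    by (rule Bochner_Integration.integrable_bound[OF integrable_running_max[OF u, of n]])
       (auto simp: abs_mult A01 mult_left_le_one_le)
  \<comment> \<open>the increment of the running maximum over \<open>U\<close>, with the first coordinate split off\<close>
  define d where "d n = (\<lambda>(x, w). A w * (max 0 (u x + ?R n w) - ?R n w))" for n
  have d_nonneg: "0 \<le> integral\<^sup>L (M \<Otimes>\<^sub>M S) (d n)" for n
  proof -
    have i1: "integrable (M \<Otimes>\<^sub>M S) (\<lambda>(x, w). A w * max 0 (u x + ?R n w))"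
      and e1: "(\<integral>(x, w). A w * max 0 (u x + ?R n w) \<partial>(M \<Otimes>\<^sub>M S)) = (\<integral>w. A w * ?R (Suc n) w \<partial>S)"
    proof -
      have "integrable (distr (M \<Otimes>\<^sub>M S) S (\<lambda>(x, w). case_nat x w)) (\<lambda>w. A w * ?R (Suc n) w)"
        unfolding PiM_iter by (rule int_AR)
      then show "integrable (M \<Otimes>\<^sub>M S) (\<lambda>(x, w). A w * max 0 (u x + ?R n w))"
        by (subst (asm) integrable_distr_eq) (auto simp: case_prod_beta' A_shift R_shift simp del: running_max.simps)
      have "(\<integral>w. A w * ?R (Suc n) w \<partial>(distr (M \<Otimes>\<^sub>M S) S (\<lambda>(x, w). case_nat x w)))
          = (\<integral>(x, w). A w * max 0 (u x + ?R n w) \<partial>(M \<Otimes>\<^sub>M S))"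
        by (subst integral_distr) (auto simp: case_prod_beta' A_shift R_shift simp del: running_max.simps)
      then show "(\<integral>(x, w). A w * max 0 (u x + ?R n w) \<partial>(M \<Otimes>\<^sub>M S)) = (\<integral>w. A w * ?R (Suc n) w \<partial>S)"
        unfolding PiM_iter by simp
    qed
    have i2: "integrable (M \<Otimes>\<^sub>M S) (\<lambda>(x, w). A w * ?R n w)"
      and e2: "(\<integral>(x, w). A w * ?R n w \<partial>(M \<Otimes>\<^sub>M S)) = (\<integral>w. A w * ?R n w \<partial>S)"
    proof -
      have snd: "distr (M \<Otimes>\<^sub>M S) S snd = S"
      proof -
        have "distr (M \<Otimes>\<^sub>M S) S snd = distr (S \<Otimes>\<^sub>M M) S fst"
          by (subst MS.distr_pair_swap) (simp add: distr_distr comp_def case_prod_beta')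
        also have "\<dots> = S" by (rule M.distr_pair_fst)
        finally show ?thesis .
      qed
      show "integrable (M \<Otimes>\<^sub>M S) (\<lambda>(x, w). A w * ?R n w)"
        using int_AR[of n] integrable_distr_eq[of snd "M \<Otimes>\<^sub>M S" S "\<lambda>w. A w * ?R n w"] snd
        by (simp add: case_prod_beta')
      show "(\<integral>(x, w). A w * ?R n w \<partial>(M \<Otimes>\<^sub>M S)) = (\<integral>w. A w * ?R n w \<partial>S)"
        using integral_distr[of snd "M \<Otimes>\<^sub>M S" S "\<lambda>w. A w * ?R n w"] snd
        by (simp add: case_prod_beta')
    qed
    have "integral\<^sup>L (M \<Otimes>\<^sub>M S) (d n) =
        (\<integral>(x, w). A w * max 0 (u x + ?R n w) \<partial>(M \<Otimes>\<^sub>M S)) - (\<integral>(x, w). A w * ?R n w \<partial>(M \<Otimes>\<^sub>M S))"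
      using Bochner_Integration.integral_diff[OF i1 i2]
      by (simp add: d_def case_prod_beta' algebra_simps)
    also have "\<dots> = (\<integral>w. A w * ?R (Suc n) w \<partial>S) - (\<integral>w. A w * ?R n w \<partial>S)"
      using e1 e2 by simp
    also have "\<dots> \<ge> 0"
      using integral_mono[OF int_AR int_AR, of n "Suc n"] mult_left_mono[OF running_max_Suc_mono A01(1)]
      by auto
    finally show ?thesis .
  qed
  have "(\<lambda>n. integral\<^sup>L (M \<Otimes>\<^sub>M S) (d n)) \<longlonglongrightarrow> (\<integral>(x, w). A w * u x \<partial>(M \<Otimes>\<^sub>M S))"
  proof (rule integral_dominated_convergence[where w = "\<lambda>(x, w). \<bar>u x\<bar>"])
    show "integrable (M \<Otimes>\<^sub>M S) (\<lambda>(x, w). \<bar>u x\<bar>)"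
      using integrable_abs[OF int_fst] by (simp add: case_prod_beta')
    show "AE z in M \<Otimes>\<^sub>M S. norm (d n z) \<le> (case z of (x, w) \<Rightarrow> \<bar>u x\<bar>)" for n
    proof (rule AE_I2)
      fix z :: "'a \<times> (nat \<Rightarrow> 'a)"
      show "norm (d n z) \<le> (case z of (x, w) \<Rightarrow> \<bar>u x\<bar>)"
        using running_max_nonneg[of u n "snd z"]
        by (cases "U (snd z)") (auto simp: d_def A_def case_prod_beta' max_def)
    qed
    show "AE z in M \<Otimes>\<^sub>M S. (\<lambda>n. d n z) \<longlonglongrightarrow> (case z of (x, w) \<Rightarrow> A w * u x)"
    proof (rule AE_I2)
      fix z :: "'a \<times> (nat \<Rightarrow> 'a)"
      obtain x w where z: "z = (x, w)" by force
      show "(\<lambda>n. d n z) \<longlonglongrightarrow> (case z of (x, w) \<Rightarrow> A w * u x)"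
      proof (cases "U w")
        case True
        obtain c :: nat where c: "\<bar>u x\<bar> < real c" using reals_Archimedean2 by blast
        obtain N where N: "real c < ?R N w" using True unfolding U_def by blast
        have "\<forall>\<^sub>F n in sequentially. d n z = A w * u x"
          using eventually_ge_at_top[of N]
        proof eventually_elim
          case (elim n)
          then have "real c < ?R n w" using N running_max_mono[of N n u w] by linarith
          then show ?case using c by (simp add: z d_def max_def)
        qed
        then show ?thesis by (simp add: z tendsto_eventually)
      qed (simp add: z d_def A_def)
    qed
  qed (auto simp: d_def case_prod_beta')
  then have "0 \<le> (\<integral>(x, w). A w * u x \<partial>(M \<Otimes>\<^sub>M S))"
    using d_nonneg by (intro LIMSEQ_le_const) auto
  also have "\<dots> = (\<integral>x. (\<integral>w. A w * u x \<partial>S) \<partial>M)"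
    using MS.integral_fst[OF int_Au] by simp
  also have "\<dots> = integral\<^sup>L S A * integral\<^sup>L M u" by simp
  finally have "integral\<^sup>L S A \<le> 0" using neg by (simp add: zero_le_mult_iff)
  moreover have A_int: "integrable S A"
    by (rule P.integrable_const_bound[of _ 1]) (auto simp: A01)
  ultimately have "integral\<^sup>L S A = 0"
    using integral_nonneg_AE[where M = S and f = A] A01 by (simp add: antisym)
  then have "AE w in S. A w = 0"
    using integral_nonneg_eq_0_iff_AE[OF A_int] A01 by simp
  then show ?thesis
  proof eventually_elim
    case (elim w)
    then obtain c :: nat where c: "\<And>n. ?R n w \<le> real c"
      unfolding A_def U_def by (auto simp: not_less split: if_splits)
    show ?case using order_trans[OF sum_le_running_max c] by blast
  qed
qed

text \<open>
  Subtracting the mean plus \<open>e / 2\<close> makes the drift negative; the partial sums are then bounded, and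
  the bound disappears after division by \<open>n\<close>.
\<close>

lemma (in sequence_space) AE_mean_eventually_less:
  assumes u: "integrable M u" and e: "0 < (e::real)"
  shows "AE w in S. \<forall>\<^sub>F n in sequentially. (\<Sum>i<n. u (w i)) / real n < integral\<^sup>L M u + e"
proof -
  let ?v = "\<lambda>x. u x - (integral\<^sup>L M u + e / 2)"
  have "AE w in S. \<exists>c::real. \<forall>n. (\<Sum>i<n. ?v (w i)) \<le> c"
  proof (rule AE_bounded_partial_sums)
    show "integrable M ?v" using u by auto
    show "integral\<^sup>L M ?v < 0" using u e by (simp add: M.prob_space)
  qed
  then show ?thesis
  proof eventually_elim
    case (elim w)
    then obtain c where c: "\<And>n. (\<Sum>i<n. ?v (w i)) \<le> c" by blast
    obtain N :: nat where N: "2 * \<bar>c\<bar> / e < real N" using reals_Archimedean2 by blast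
    show ?case using eventually_gt_at_top[of N] 
    proof eventually_elim
      case (elim n)
      have n: "2 * \<bar>c\<bar> / e < real n" "0 < real n" using N elim by auto
      have "(\<Sum>i<n. u (w i)) \<le> c + real n * (integral\<^sup>L M u + e / 2)"
        using c[of n] by (simp add: sum_subtractf)
      also have "\<dots> < real n * (integral\<^sup>L M u + e)"
        using n e by (auto simp: field_simps)
      finally show ?case using n by (simp add: field_simps)
    qed
  qed
qed

lemma (in sequence_space) strong_law_sequence_space:
  assumes u: "integrable M u"
  shows "AE w in S. (\<lambda>n. (\<Sum>i<n. u (w i)) / real n) \<longlonglongrightarrow> (integral\<^sup>L M u :: real)"
proof -
  have "AE w in S. \<forall>k::nat. (\<forall>\<^sub>F n in sequentially. (\<Sum>i<n. u (w i)) / real n < integral\<^sup>L M u + 1 / real (Suc k))"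
    by (subst AE_all_countable) (auto intro!: AE_mean_eventually_less u)
  moreover have "AE w in S. \<forall>k::nat. (\<forall>\<^sub>F n in sequentially. (\<Sum>i<n. - u (w i)) / real n < integral\<^sup>L M (\<lambda>x. - u x) + 1 / real (Suc k))"
    by (subst AE_all_countable) (auto intro!: AE_mean_eventually_less[where u = "\<lambda>x. - u x"] u simp del: integral_minus of_nat_Suc)
  ultimately show ?thesis
  proof eventually_elim
    case (elim w)
    show ?case
    proof (rule LIMSEQ_I)
      fix r :: real assume "0 < r"
      then obtain k where k: "1 / real (Suc k) < r" using nat_approx_posE by (metis)
      have "\<forall>\<^sub>F n in sequentially. norm ((\<Sum>i<n. u (w i)) / real n - integral\<^sup>L M u) < r"
        using elim(1)[rule_format, of k] elim(2)[rule_format, of k]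
      proof eventually_elim
        case (elim n)
        then show ?case using k by (auto simp: sum_negf abs_less_iff)
      qed
      then show "\<exists>no. \<forall>n\<ge>no. norm ((\<Sum>i<n. u (w i)) / real n - integral\<^sup>L M u) < r"
        by (simp add: eventually_sequentially)
    qed
  qed
qed

text \<open>
  A sequence of independent identically distributed variables has the law of the coordinates on the
  product space, so the almost sure statement carries over from there.
\<close>

theorem (in prob_space) strong_law_of_large_numbers:
  fixes u :: "'b \<Rightarrow> real"
  assumes indep: "indep_vars (\<lambda>_. N) Y UNIV" and dist: "\<And>j. distr M N (Y j) = Q"
    and u: "integrable Q u"
  shows "AE \<omega> in M. (\<lambda>n. (\<Sum>j<n. u (Y j \<omega>)) / real n) \<longlonglongrightarrow> integral\<^sup>L Q u"
proof -
  have Y [measurable]: "Y j \<in> measurable M N" for j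
    using indep unfolding indep_vars_def by auto
  have sets [measurable_cong]: "sets Q = sets N" using dist[of 0] by auto
  have "prob_space Q" unfolding dist[of 0, symmetric] by (rule prob_space_distr) simp
  then interpret Q: sequence_space Q
    by (simp add: sequence_space_def product_prob_space_def product_prob_space_axioms_def
        product_sigma_finite_def prob_space_imp_sigma_finite)
  let ?Y = "\<lambda>\<omega> j. Y j \<omega>"
  have Y_meas: "?Y \<in> measurable M Q.S"
    by (rule measurable_PiM_single') (auto simp: sets_eq_imp_space_eq[OF sets] measurable_space[OF Y])
  have "distr M Q.S ?Y = distr M (PiM UNIV (\<lambda>_. N)) (\<lambda>\<omega>. \<lambda>j\<in>UNIV. Y j \<omega>)"
    by (intro distr_cong sets_PiM_cong) (auto simp: sets)
  also have "\<dots> = PiM UNIV (\<lambda>j. distr M N (Y j))"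
    using indep by (subst (asm) indep_vars_iff_distr_eq_PiM) auto
  also have "\<dots> = Q.S" by (simp only: dist)
  finally have D: "distr M Q.S ?Y = Q.S" .
  have "AE w in distr M Q.S ?Y. (\<lambda>n. (\<Sum>i<n. u (w i)) / real n) \<longlonglongrightarrow> integral\<^sup>L Q u"
    unfolding D by (rule Q.strong_law_sequence_space[OF u])
  then show ?thesis by (rule AE_distrD[OF Y_meas])
qed

section \<open>Bounds for one realization of the samples\<close>

text \<open>
  For one realization of the samples: if the Monte Carlo marginal is uniformly within a factor close
  to one of the true marginal, then replacing one by the other changes each logarithm by at most \<open>e\<close>,
  and the empirical mean of the true logarithms converges.  Uniformity is what allows \<open>m\<close> and \<open>n\<close> to
  tend to infinity at unrelated rates.
\<close>

lemma limsup_KL_mc_le: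
  assumes g: "\<And>j. 0 < g (ys j)" and F: "\<And>j. 0 < F (ys j)"
    and unif: "\<And>\<delta>. 0 < \<delta> \<Longrightarrow> \<forall>\<^sub>F m in sequentially. \<forall>j. \<bar>mc_marginal h f xs m \<theta> (ys j) / F (ys j) - 1\<bar> < \<delta>"
    and mean: "(\<lambda>n. (\<Sum>j<n. ln (g (ys j) / F (ys j))) / real n) \<longlonglongrightarrow> c"
    and m: "filterlim m at_top sequentially" and n: "filterlim n at_top sequentially"
  shows "limsup (\<lambda>k. KL_mc h g f xs ys (m k) (n k) \<theta>) \<le> ereal c"
proof (rule ereal_le_epsilon2)
  fix e :: real assume e: "0 < e"
  define A where "A n = (\<Sum>j<n. ln (g (ys j) / F (ys j))) / real n" for n
  \<comment> \<open>the tolerance is chosen so that a ratio within it of one has logarithm above \<open>- e\<close>\<close>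
  have "\<forall>\<^sub>F k in sequentially. \<forall>j. \<bar>mc_marginal h f xs (m k) \<theta> (ys j) / F (ys j) - 1\<bar> < 1 - exp (- e)"
    using e m by (intro filterlim_iff[THEN iffD1, rule_format, OF m] unif) auto
  moreover have "\<forall>\<^sub>F k in sequentially. 1 \<le> n k"
    using n unfolding filterlim_at_top by blast
  ultimately have "\<forall>\<^sub>F k in sequentially. KL_mc h g f xs ys (m k) (n k) \<theta> \<le> ereal (A (n k) + e)"
  proof eventually_elim
    case (elim k)
    have "ext_ln (ennreal (g (ys j)) / ennreal (mc_marginal h f xs (m k) \<theta> (ys j)))
        \<le> ereal (ln (g (ys j) / F (ys j)) + e)" for j
    proof -
      define r where "r = mc_marginal h f xs (m k) \<theta> (ys j) / F (ys j)"
      have "\<bar>r - 1\<bar> < 1 - exp (- e)" using elim(1) unfolding r_def by blast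
      then have r: "exp (- e) < r" by linarith
      then have r0: "0 < r" using exp_gt_zero[of "- e"] by linarith
      have mc: "mc_marginal h f xs (m k) \<theta> (ys j) = r * F (ys j)"
        using F[of j] by (simp add: r_def)
      have "- e < ln r" using r r0 by (metis ln_exp ln_less_cancel_iff exp_gt_zero)
      moreover have "ln (g (ys j) / (r * F (ys j))) = ln (g (ys j) / F (ys j)) - ln r"
        using g[of j] F[of j] r0 by (simp add: ln_div ln_mult)
      ultimately show ?thesis
        unfolding mc using g[of j] F[of j] r0 by (simp add: divide_ennreal ext_ln_ennreal)
    qed
    then have "(\<Sum>j<n k. ext_ln (ennreal (g (ys j)) / ennreal (mc_marginal h f xs (m k) \<theta> (ys j))))
        \<le> (\<Sum>j<n k. ereal (ln (g (ys j) / F (ys j)) + e))"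
      by (intro sum_mono)
    also have "\<dots> = ereal ((A (n k) + e) * real (n k))"
      using elim(2) by (simp add: A_def sum.distrib field_simps)
    finally have "KL_mc h g f xs ys (m k) (n k) \<theta> \<le> ereal ((A (n k) + e) * real (n k)) / ereal (real (n k))"
      unfolding KL_mc_def by (intro ereal_divide_right_mono) (use elim(2) in auto)
    then show ?case using elim(2) by simp
  qed
  then have "limsup (\<lambda>k. KL_mc h g f xs ys (m k) (n k) \<theta>) \<le> limsup (\<lambda>k. ereal (A (n k) + e))"
    by (rule Limsup_mono)
  also have "\<dots> = ereal (c + e)"
  proof (rule lim_imp_Limsup)
    have "(\<lambda>k. A (n k)) \<longlonglongrightarrow> c"
      using filterlim_compose[OF mean n] unfolding A_def .
    then show "(\<lambda>k. ereal (A (n k) + e)) \<longlonglongrightarrow> ereal (c + e)"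
      by (intro tendsto_intros)
  qed simp
  finally show "limsup (\<lambda>k. KL_mc h g f xs ys (m k) (n k) \<theta>) \<le> ereal c + ereal e" by simp
qed

lemma mc_marginal_le_sup_ratio:
  assumes hp: "\<And>i. 0 < h (xs i)" and gp: "0 < g y" and \<phi>: "\<phi> \<in> V"
    and bdd: "\<And>i. bdd_above ((\<lambda>\<phi>. f \<phi> (xs i) y) ` V)"
  shows "mc_marginal h f xs m \<phi> y \<le> g y * ((\<Sum>i<m. sup_ratio h g f V y (xs i)) / real m)"
proof -
  have "f \<phi> (xs i) y / h (xs i) \<le> g y * sup_ratio h g f V y (xs i)" for i
  proof -
    have "f \<phi> (xs i) y \<le> (SUP \<phi>\<in>V. f \<phi> (xs i) y)" by (rule cSUP_upper[OF \<phi> bdd])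
    then show ?thesis using hp[of i] gp by (simp add: sup_ratio_def divide_right_mono)
  qed
  then have "(\<Sum>i<m. f \<phi> (xs i) y / h (xs i)) \<le> g y * (\<Sum>i<m. sup_ratio h g f V y (xs i))"
    unfolding sum_distrib_left by (intro sum_mono)
  then show ?thesis unfolding mc_marginal_def
    by (metis divide_right_mono of_nat_0_le_iff times_divide_eq_right)
qed

text \<open>
  For one realization of the samples: the supremum of the densities over \<open>V\<close> dominates each of them,
  and its Monte Carlo mean is eventually below \<open>s + e\<close> uniformly in \<open>y\<close>, which bounds all
  \<open>\<phi> \<in> V\<close> at once.  Adding \<open>e\<close> inside the logarithm keeps it away from zero, where a uniform error
  would not be controlled on the logarithmic scale.
\<close>

lemma le_liminf_INF_KL_mc:
  assumes g: "\<And>j. 0 < g (ys j)" and h: "\<And>i. 0 < h (xs i)"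
    and bdd: "\<And>i j. bdd_above ((\<lambda>\<phi>. f \<phi> (xs i) (ys j)) ` V)"
    and nonneg: "\<And>\<phi> i j. \<phi> \<in> V \<Longrightarrow> 0 \<le> f \<phi> (xs i) (ys j)"
    and e: "0 < e" and s: "\<And>j. 0 \<le> s (ys j)"
    and unif: "\<forall>\<^sub>F m in sequentially. \<forall>j. \<bar>(\<Sum>i<m. sup_ratio h g f V (ys j) (xs i)) / real m - s (ys j)\<bar> < e"
    and mean: "(\<lambda>n. (\<Sum>j<n. ln (e + s (ys j))) / real n) \<longlonglongrightarrow> c"
    and m: "filterlim m at_top sequentially" and n: "filterlim n at_top sequentially"
  shows "ereal (- c) \<le> liminf (\<lambda>k. INF \<phi>\<in>V. KL_mc h g f xs ys (m k) (n k) \<phi>)"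
proof -
  define A where "A n = (\<Sum>j<n. ln (e + s (ys j))) / real n" for n
  have "ereal (- c) = liminf (\<lambda>k. ereal (- A (n k)))"
  proof (rule lim_imp_Liminf[symmetric])
    have "(\<lambda>k. A (n k)) \<longlonglongrightarrow> c"
      using filterlim_compose[OF mean n] unfolding A_def .
    then show "(\<lambda>k. ereal (- A (n k))) \<longlonglongrightarrow> ereal (- c)"
      by (intro tendsto_intros)
  qed simp
  also have "\<dots> \<le> liminf (\<lambda>k. INF \<phi>\<in>V. KL_mc h g f xs ys (m k) (n k) \<phi>)"
  proof (rule Liminf_mono)
    have "\<forall>\<^sub>F k in sequentially. \<forall>j. \<bar>(\<Sum>i<m k. sup_ratio h g f V (ys j) (xs i)) / real (m k) - s (ys j)\<bar> < e"
      by (intro filterlim_iff[THEN iffD1, rule_format, OF m] unif)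
    moreover have "\<forall>\<^sub>F k in sequentially. 1 \<le> n k"
      using n unfolding filterlim_at_top by blast
    ultimately show "\<forall>\<^sub>F k in sequentially. ereal (- A (n k)) \<le> (INF \<phi>\<in>V. KL_mc h g f xs ys (m k) (n k) \<phi>)"
    proof eventually_elim
      case (elim k)
      show ?case
      proof (rule INF_greatest)
        fix \<phi> assume \<phi>: "\<phi> \<in> V"
        have "ereal (- ln (e + s (ys j))) \<le>
            ext_ln (ennreal (g (ys j)) / ennreal (mc_marginal h f xs (m k) \<phi> (ys j)))" for j
        proof -
          let ?mc = "mc_marginal h f xs (m k) \<phi> (ys j)"
          have "?mc \<le> g (ys j) * ((\<Sum>i<m k. sup_ratio h g f V (ys j) (xs i)) / real (m k))"
            by (rule mc_marginal_le_sup_ratio) (use h g \<phi> bdd in auto)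
          also have "\<dots> \<le> g (ys j) * (e + s (ys j))"
            using elim(1)[rule_format, of j] g[of j] by (intro mult_left_mono) auto
          finally have "?mc / g (ys j) \<le> e + s (ys j)"
            using g[of j] by (simp add: field_simps)
          moreover have "0 \<le> ?mc" unfolding mc_marginal_def
            by (intro divide_nonneg_nonneg sum_nonneg nonneg \<phi>) (use h in \<open>auto intro: less_imp_le\<close>)
          ultimately have "ext_ln (ennreal ?mc / ennreal (g (ys j))) \<le> ext_ln (ennreal (e + s (ys j)))"
            using g[of j] by (intro ext_ln_mono) (simp only: divide_ennreal ennreal_leI)
          also have "\<dots> = ereal (ln (e + s (ys j)))"
            by (rule ext_ln_ennreal) (rule add_pos_nonneg[OF e s])
          finally show ?thesis
            unfolding ext_ln_divide_swap[OF g[of j], of "ennreal ?mc"] uminus_ereal.simps(1)[symmetric]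
            by (simp only: ereal_minus_le_minus)
        qed
        then have "(\<Sum>j<n k. ereal (- ln (e + s (ys j)))) \<le>
            (\<Sum>j<n k. ext_ln (ennreal (g (ys j)) / ennreal (mc_marginal h f xs (m k) \<phi> (ys j))))"
          by (intro sum_mono)
        moreover have "(\<Sum>j<n k. ereal (- ln (e + s (ys j)))) = ereal (- A (n k) * real (n k))"
          using elim(2) by (simp add: A_def sum_negf field_simps)
        ultimately have "ereal (- A (n k) * real (n k)) / ereal (real (n k)) \<le> KL_mc h g f xs ys (m k) (n k) \<phi>"
          unfolding KL_mc_def by (intro ereal_divide_right_mono) (use elim(2) in auto)
        then show "ereal (- A (n k)) \<le> KL_mc h g f xs ys (m k) (n k) \<phi>" using elim(2) by simp
      qed
    qed
  qed
  finally show ?thesis .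
qed

section \<open>A Fatou bound for the expected logarithm\<close>

lemma tendsto_ennreal_at_top:
  assumes "filterlim f at_top F"
  shows "((\<lambda>x. ennreal (f x)) \<longlongrightarrow> top) F"
proof -
  have "((\<lambda>x. ereal (f x)) \<longlongrightarrow> \<infinity>) F" using assms by (simp add: tendsto_PInfty_eq_at_top)
  then have "((\<lambda>x. e2ennreal (ereal (f x))) \<longlongrightarrow> e2ennreal \<infinity>) F"
    by (rule tendsto_e2ennrealI)
  then show ?thesis by (simp add: e2ennreal_ereal)
qed

text \<open>
  Lower semicontinuity of the objective along shrinking neighbourhoods.  The functions
  \<open>ln (1 + t) - ln (1 / (k + 1) + s k)\<close> are nonnegative and converge to \<open>ln (1 + t) - ln \<phi>\<close>, infinite
  where \<open>\<phi>\<close> vanishes, so Fatou's lemma applies.  One limit in \<open>k\<close> both shrinks the neighbourhood and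
  removes the regularization \<open>1 / (k + 1)\<close>.  Finiteness of the bound \<open>c\<close> forces \<open>\<phi> > 0\<close> almost
  everywhere, after which only real integrals remain.
\<close>

lemma ext_expectation_uminus_ext_ln_le:
  assumes "prob_space Q"
    and s [measurable]: "\<And>k. s k \<in> borel_measurable Q" and s0: "\<And>k y. 0 \<le> s k y"
    and dom: "AE y in Q. \<forall>k. s k y \<le> t y" and t: "integrable Q (\<lambda>y. ln (1 + t y))"
    and \<phi> [measurable]: "\<phi> \<in> borel_measurable Q"
    and lim: "AE y in Q. (\<lambda>k. ennreal (s k y)) \<longlonglongrightarrow> \<phi> y"
    and c: "\<And>k. - (\<integral>y. ln (1 / real (Suc k) + s k y) \<partial>Q) \<le> c"
  shows "ext_expectation Q (\<lambda>y. - ext_ln (\<phi> y)) \<le> ereal c"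
proof -
  interpret Q: prob_space Q by fact
  define e where "e k = 1 / real (Suc k)" for k
  have e: "0 < e k" "e k \<le> 1" for k by (auto simp: e_def)
  have e0: "e \<longlonglongrightarrow> 0" unfolding e_def using LIMSEQ_inverse_real_of_nat by (simp only: inverse_eq_divide)
  define D where "D y = ln (1 + t y)" for y
  have D_int: "integrable Q D" using t by (simp add: D_def[abs_def])
  then have [measurable]: "D \<in> borel_measurable Q" by auto
  have ln_le_D: "ln (e k + s k y) \<le> D y" if "s k y \<le> t y" for k y
  proof -
    have "0 < e k + s k y" "e k + s k y \<le> 1 + t y" using e[of k] s0[of k y] that by linarith+
    then show ?thesis unfolding D_def by simp
  qed
  have ln_int: "integrable Q (\<lambda>y. ln (e k + s k y))" for k
  proof (rule Bochner_Integration.integrable_bound)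
    show "integrable Q (\<lambda>y. \<bar>ln (e k)\<bar> + \<bar>D y\<bar>)" using D_int by auto
    show "AE y in Q. norm (ln (e k + s k y)) \<le> norm (\<bar>ln (e k)\<bar> + \<bar>D y\<bar>)"
      using dom
    proof eventually_elim
      case (elim y)
      have "ln (e k) \<le> ln (e k + s k y)" using e(1)[of k] s0[of k y] by simp
      moreover have "ln (e k + s k y) \<le> D y" using elim by (intro ln_le_D) auto
      ultimately show ?case by auto
    qed
  qed simp
  define v where "v k y = D y - ln (e k + s k y)" for k y
  have v_int: "integrable Q (v k)" for k unfolding v_def using D_int ln_int by auto
  then have [measurable]: "v k \<in> borel_measurable Q" for k by auto
  have v_pos: "AE y in Q. 0 \<le> v k y" for k
    using dom
  proof eventually_elim
    case (elim y)
    then have "ln (e k + s k y) \<le> D y" by (intro ln_le_D) auto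
    then show ?case by (simp add: v_def)
  qed
  then have v_pos': "AE y in Q. \<forall>k. 0 \<le> v k y" by (subst AE_all_countable) blast
  have v_le: "integral\<^sup>L Q (v k) \<le> integral\<^sup>L Q D + c" for k
    using c[of k] D_int ln_int[of k] unfolding v_def e_def by simp
  have C0: "0 \<le> integral\<^sup>L Q D + c"
    using v_le[of 0] integral_nonneg_AE[OF v_pos[of 0]] by linarith
  have "(\<integral>\<^sup>+y. liminf (\<lambda>k. ennreal (v k y)) \<partial>Q) \<le> liminf (\<lambda>k. \<integral>\<^sup>+y. ennreal (v k y) \<partial>Q)"
    by (rule nn_integral_liminf) simp
  also have "\<dots> = liminf (\<lambda>k. ennreal (integral\<^sup>L Q (v k)))"
    using v_int v_pos by (simp add: nn_integral_eq_integral)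
  also have "\<dots> \<le> ennreal (integral\<^sup>L Q D + c)"
  proof -
    have "liminf (\<lambda>k. ennreal (integral\<^sup>L Q (v k))) \<le> liminf (\<lambda>k::nat. ennreal (integral\<^sup>L Q D + c))"
      by (intro Liminf_mono always_eventually allI ennreal_leI v_le)
    then show ?thesis by (simp add: Liminf_const)
  qed
  finally have fatou: "(\<integral>\<^sup>+y. liminf (\<lambda>k. ennreal (v k y)) \<partial>Q) \<le> ennreal (integral\<^sup>L Q D + c)" .
  then have "(\<integral>\<^sup>+y. liminf (\<lambda>k. ennreal (v k y)) \<partial>Q) < \<infinity>"
    using ennreal_less_top le_less_trans by (metis infinity_ennreal_def)
  then have fin: "AE y in Q. liminf (\<lambda>k. ennreal (v k y)) \<noteq> \<infinity>"
    by (intro nn_integral_PInf_AE) auto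
  define w where "w y = - ln (enn2real (\<phi> y))" for y
  have w_meas [measurable]: "w \<in> borel_measurable Q" unfolding w_def by measurable
  have key: "AE y in Q. - ext_ln (\<phi> y) = ereal (w y) \<and> 0 \<le> D y + w y \<and>
      liminf (\<lambda>k. ennreal (v k y)) = ennreal (D y + w y)"
    using dom lim fin v_pos'
  proof eventually_elim
    case (elim y)
    have "\<phi> y \<le> ennreal (t y)"
      using elim by (intro LIMSEQ_le_const2[OF elim(2)]) (auto intro: ennreal_leI)
    then obtain r where r: "0 \<le> r" "\<phi> y = ennreal r"
      by (metis ennreal_cases ennreal_neq_top neq_top_trans top_neq_ennreal)
    have sr: "(\<lambda>k. s k y) \<longlonglongrightarrow> r"
      using elim(2) s0 r by (simp add: tendsto_ennreal_iff)
    have esr: "(\<lambda>k. e k + s k y) \<longlonglongrightarrow> r" using tendsto_add[OF e0 sr] by simp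
    have "r \<noteq> 0"
    proof
      assume "r = 0"
      with esr have "(\<lambda>k. e k + s k y) \<longlonglongrightarrow> 0" by simp
      moreover have pos: "0 < e k + s k y" for k using e(1)[of k] s0[of k y] by linarith
      ultimately have "filterlim (\<lambda>k. e k + s k y) (at_right 0) sequentially"
        by (simp add: filterlim_at pos less_imp_neq[OF pos, symmetric])
      then have "filterlim (\<lambda>k. ln (e k + s k y)) at_bot sequentially"
        by (rule filterlim_compose[OF ln_at_0])
      then have "filterlim (\<lambda>k. - ln (e k + s k y)) at_top sequentially"
        by (simp add: filterlim_uminus_at_top)
      then have "filterlim (\<lambda>k. v k y) at_top sequentially"
        unfolding v_def diff_conv_add_uminus by (rule filterlim_tendsto_add_at_top[OF tendsto_const])
      then have "(\<lambda>k. ennreal (v k y)) \<longlonglongrightarrow> \<infinity>"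
        unfolding infinity_ennreal_def by (rule tendsto_ennreal_at_top)
      then have "liminf (\<lambda>k. ennreal (v k y)) = \<infinity>" by (intro lim_imp_Liminf) auto
      with elim show False by simp
    qed
    then have r0: "0 < r" using r by simp
    have vw: "(\<lambda>k. v k y) \<longlonglongrightarrow> D y + w y"
    proof -
      have "(\<lambda>k. v k y) \<longlonglongrightarrow> D y - ln r" unfolding v_def
        using r0 by (intro tendsto_intros esr) auto
      then show ?thesis using r by (simp add: w_def)
    qed
    have "0 \<le> D y + w y" using vw elim by (intro LIMSEQ_le_const[OF vw]) auto
    moreover have "liminf (\<lambda>k. ennreal (v k y)) = ennreal (D y + w y)"
      by (intro lim_imp_Liminf tendsto_ennrealI vw) auto
    moreover have "- ext_ln (\<phi> y) = ereal (w y)" using r0 r by (simp add: ext_ln_ennreal w_def)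
    ultimately show ?case by blast
  qed
  have Dw: "(\<integral>\<^sup>+y. ennreal (D y + w y) \<partial>Q) \<le> ennreal (integral\<^sup>L Q D + c)"
  proof -
    have "(\<integral>\<^sup>+y. ennreal (D y + w y) \<partial>Q) = (\<integral>\<^sup>+y. liminf (\<lambda>k. ennreal (v k y)) \<partial>Q)"
      by (rule nn_integral_cong_AE) (use key in eventually_elim, simp)
    with fatou show ?thesis by simp
  qed
  have Dw_int: "integrable Q (\<lambda>y. D y + w y)"
  proof (rule integrableI_nonneg)
    show "AE y in Q. 0 \<le> D y + w y" using key by eventually_elim simp
    show "(\<integral>\<^sup>+y. ennreal (D y + w y) \<partial>Q) < \<infinity>"
      using Dw ennreal_less_top le_less_trans by (metis infinity_ennreal_def)
  qed simp
  have w_int: "integrable Q w"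
    using Bochner_Integration.integrable_diff[OF Dw_int D_int] by simp
  have "ext_expectation Q (\<lambda>y. - ext_ln (\<phi> y)) = ereal (integral\<^sup>L Q w)"
    by (rule ext_expectation_eq_integral[OF w_int]) (use key in eventually_elim, simp)
  also have "ennreal (\<integral>y. D y + w y \<partial>Q) \<le> ennreal (integral\<^sup>L Q D + c)"
    using Dw nn_integral_eq_integral[OF Dw_int] key by auto
  then have "(\<integral>y. D y + w y \<partial>Q) \<le> integral\<^sup>L Q D + c" using C0 by (simp add: ennreal_le_iff)
  then have "integral\<^sup>L Q w \<le> c" using D_int w_int by simp
  finally show ?thesis by simp
qed

section \<open>Almost sure properties of samples\<close>

lemma (in prob_space) AE_all_sample:
  assumes "\<And>i. X i \<in> measurable M N" "\<And>i. distr M N (X i) = P" "AE x in P. R x"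
  shows "AE \<omega> in M. \<forall>i::nat. R (X i \<omega>)"
proof (subst AE_all_countable, rule allI)
  fix i
  have "AE x in distr M N (X i). R x" unfolding assms(2) by (rule assms(3))
  then show "AE \<omega> in M. R (X i \<omega>)" by (rule AE_distrD[OF assms(1)])
qed

text \<open>
  The Glivenko-Cantelli property holds outside a null set for all tolerances and all members of the
  family at once, so it may later be evaluated at the random points \<open>y = Y j \<omega>\<close>.
\<close>

lemma glivenko_cantelli_AE_uniform:
  assumes "glivenko_cantelli M X P (a ` S)"
  shows "AE \<omega> in M. \<forall>\<delta>>0. \<forall>\<^sub>F m in sequentially. \<forall>y\<in>S.
    \<bar>(\<Sum>i<m. a y (X i \<omega>)) / real m - (\<integral>x. a y x \<partial>P)\<bar> < \<delta>"
proof -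
  have "AE \<omega> in M. (\<lambda>m. SUP u \<in> a ` S. ennreal \<bar>(\<Sum>i<m. u (X i \<omega>)) / real m - (\<integral>x. u x \<partial>P)\<bar>)
       \<longlonglongrightarrow> 0"
    using assms unfolding glivenko_cantelli_def by blast
  then show ?thesis
  proof eventually_elim
    case (elim \<omega>)
    show ?case
    proof (intro allI impI)
      fix \<delta> :: real assume "0 < \<delta>"
      then have "\<forall>\<^sub>F m in sequentially.
          (SUP u \<in> a ` S. ennreal \<bar>(\<Sum>i<m. u (X i \<omega>)) / real m - (\<integral>x. u x \<partial>P)\<bar>) < ennreal \<delta>"
        using elim by (intro order_tendstoD(2)) auto
      then show "\<forall>\<^sub>F m in sequentially. \<forall>y\<in>S.
          \<bar>(\<Sum>i<m. a y (X i \<omega>)) / real m - (\<integral>x. a y x \<partial>P)\<bar> < \<delta>"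
      proof eventually_elim
        case (elim m)
        show ?case
        proof
          fix y assume "y \<in> S"
          then have "ennreal \<bar>(\<Sum>i<m. a y (X i \<omega>)) / real m - (\<integral>x. a y x \<partial>P)\<bar> < ennreal \<delta>"
            by (intro le_less_trans[OF SUP_upper elim]) auto
          then show "\<bar>(\<Sum>i<m. a y (X i \<omega>)) / real m - (\<integral>x. a y x \<partial>P)\<bar> < \<delta>"
            by (simp add: ennreal_less_iff)
        qed
      qed
    qed
  qed
qed

lemma ennreal_cSUP:
  assumes "V \<noteq> {}" "bdd_above (u ` V)"
  shows "ennreal (SUP \<phi>\<in>V. u \<phi>) = (SUP \<phi>\<in>V. ennreal (u \<phi>))"
proof -
  have "continuous_on UNIV ennreal"
    by (intro continuous_on_ennreal continuous_on_id)
  then have "continuous (at (Sup (u ` V)) within UNIV) ennreal"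
    unfolding continuous_on_eq_continuous_within by blast
  then have "continuous (at_left (Sup (u ` V))) ennreal"
    by (rule continuous_within_subset) simp
  then have "ennreal (Sup (u ` V)) = (SUP r\<in>u ` V. ennreal r)"
    using assms by (intro continuous_at_Sup_mono) (auto simp: mono_def ennreal_leI)
  then show ?thesis by (simp add: image_image)
qed

section \<open>Importance sampling\<close>

locale importance_sampling =
  fixes \<Theta> :: "'t set" and \<mu> P :: "'x measure" and \<nu> Q :: "'y measure" and M :: "'w measure"
    and f :: "'t \<Rightarrow> 'x \<Rightarrow> 'y \<Rightarrow> real" and h :: "'x \<Rightarrow> real" and g :: "'y \<Rightarrow> real"
    and X :: "nat \<Rightarrow> 'w \<Rightarrow> 'x" and Y :: "nat \<Rightarrow> 'w \<Rightarrow> 'y"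
  assumes sigma_finite: "sigma_finite_measure \<mu>" "sigma_finite_measure \<nu>"
    and f_meas: "\<And>\<theta>. \<theta> \<in> \<Theta> \<Longrightarrow> (\<lambda>(x, y). f \<theta> x y) \<in> borel_measurable (\<mu> \<Otimes>\<^sub>M \<nu>)"
    and f_nonneg: "\<And>\<theta> x y. \<theta> \<in> \<Theta> \<Longrightarrow> x \<in> space \<mu> \<Longrightarrow> y \<in> space \<nu> \<Longrightarrow> 0 \<le> f \<theta> x y"
    and f_density: "\<And>\<theta>. \<theta> \<in> \<Theta> \<Longrightarrow> (\<integral>\<^sup>+ (x, y). ennreal (f \<theta> x y) \<partial>(\<mu> \<Otimes>\<^sub>M \<nu>)) = 1"
    and P: "prob_space P" "P = density \<mu> (\<lambda>x. ennreal (h x))"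
    and h: "h \<in> borel_measurable \<mu>"
    and Q: "prob_space Q" "Q = density \<nu> (\<lambda>y. ennreal (g y))"
    and g: "g \<in> borel_measurable \<nu>"
    and M: "prob_space M"
    and X_rv: "\<And>i. X i \<in> measurable M \<mu>" and X_dist: "\<And>i. distr M \<mu> (X i) = P"
    and Y_iid: "prob_space.indep_vars M (\<lambda>_. \<nu>) Y UNIV" "\<And>j. distr M \<nu> (Y j) = Q"
    and importance: "\<And>\<theta> y. \<theta> \<in> \<Theta> \<Longrightarrow> y \<in> space \<nu> \<Longrightarrow>
          (\<integral>\<^sup>+ x. ennreal (f \<theta> x y / h x) \<partial>P) = marginal \<mu> f \<theta> y"
begin

sublocale P: prob_space P by (rule P)
sublocale Q: prob_space Q by (rule Q)
sublocale M: prob_space M by (rule M)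

lemma sets_P [measurable_cong]: "sets P = sets \<mu>" and space_P: "space P = space \<mu>"
  by (simp_all add: P(2))

lemma sets_Q [measurable_cong]: "sets Q = sets \<nu>" and space_Q: "space Q = space \<nu>"
  by (simp_all add: Q(2))

lemma h_measurable [measurable]: "h \<in> borel_measurable \<mu>" by (rule h)
lemma g_measurable [measurable]: "g \<in> borel_measurable \<nu>" by (rule g)

lemma AE_h_pos: "AE x in P. x \<in> space \<mu> \<and> 0 < h x"
proof -
  have "AE x in P. 0 < h x" unfolding P(2) by (subst AE_density) auto
  then show ?thesis using AE_space by eventually_elim (simp add: space_P)
qed

lemma AE_g_pos: "AE y in Q. y \<in> space \<nu> \<and> 0 < g y"
proof -
  have "AE y in Q. 0 < g y" unfolding Q(2) by (subst AE_density) auto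
  then show ?thesis using AE_space by eventually_elim (simp add: space_Q)
qed

lemma Y_rv: "Y j \<in> measurable M \<nu>"
  using Y_iid(1) unfolding M.indep_vars_def by auto

lemmas AE_all_X = M.AE_all_sample[where X = X, OF X_rv X_dist]
lemmas AE_all_Y = M.AE_all_sample[where X = Y, OF Y_rv Y_iid(2)]

lemma f_swap_measurable:
  assumes "\<theta> \<in> \<Theta>"
  shows "(\<lambda>(y, x). f \<theta> x y) \<in> borel_measurable (\<nu> \<Otimes>\<^sub>M \<mu>)"
  using measurable_compose[OF measurable_pair_swap' f_meas[OF assms]] by (simp add: case_prod_beta')

lemma f_section_measurable:
  assumes "\<theta> \<in> \<Theta>" "y \<in> space \<nu>"
  shows "(\<lambda>x. f \<theta> x y) \<in> borel_measurable \<mu>"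
  using measurable_Pair2[OF f_swap_measurable[OF assms(1)] assms(2)] by simp

lemma marginal_measurable:
  assumes "\<theta> \<in> \<Theta>"
  shows "marginal \<mu> f \<theta> \<in> borel_measurable \<nu>"
proof -
  interpret \<mu>: sigma_finite_measure \<mu> by (rule sigma_finite)
  note f_swap_measurable[OF assms, measurable]
  show ?thesis unfolding marginal_def[abs_def] by measurable
qed

lemma nn_integral_marginal:
  assumes "\<theta> \<in> \<Theta>"
  shows "(\<integral>\<^sup>+y. marginal \<mu> f \<theta> y \<partial>\<nu>) = 1"
proof -
  interpret pair_sigma_finite \<mu> \<nu> using sigma_finite by (simp add: pair_sigma_finite_def)
  note f_meas[OF assms, measurable]
  have "(\<integral>\<^sup>+y. marginal \<mu> f \<theta> y \<partial>\<nu>) = (\<integral>\<^sup>+z. (case z of (x, y) \<Rightarrow> ennreal (f \<theta> x y)) \<partial>(\<mu> \<Otimes>\<^sub>M \<nu>))"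
    unfolding marginal_def
    by (subst nn_integral_snd[symmetric]) (auto simp: case_prod_beta')
  also have "\<dots> = 1" using f_density[OF assms] .
  finally show ?thesis .
qed

text \<open>
  The integral of \<open>f\<^sub>\<theta>(y) / g(y)\<close> against \<open>Q\<close> is that of \<open>f\<^sub>\<theta>(y)\<close> over \<open>g(y) > 0\<close>, at most one.
\<close>

lemma KL_negative_part_finite:
  assumes "\<theta> \<in> \<Theta>"
  shows "(\<integral>\<^sup>+y. e2ennreal (- ext_ln (ennreal (g y) / marginal \<mu> f \<theta> y)) \<partial>Q) < \<infinity>"
proof -
  note marginal_measurable[OF assms, measurable]
  have "(\<integral>\<^sup>+y. e2ennreal (- ext_ln (ennreal (g y) / marginal \<mu> f \<theta> y)) \<partial>Q)
      \<le> (\<integral>\<^sup>+y. marginal \<mu> f \<theta> y / ennreal (g y) \<partial>Q)"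
    by (rule nn_integral_mono_AE)
       (use AE_g_pos in eventually_elim, auto intro: e2ennreal_uminus_ext_ln_le)
  also have "\<dots> = (\<integral>\<^sup>+y. ennreal (g y) * (marginal \<mu> f \<theta> y / ennreal (g y)) \<partial>\<nu>)"
    unfolding Q(2) by (rule nn_integral_density) auto
  also have "\<dots> \<le> (\<integral>\<^sup>+y. marginal \<mu> f \<theta> y \<partial>\<nu>)"
  proof (rule nn_integral_mono)
    fix y
    show "ennreal (g y) * (marginal \<mu> f \<theta> y / ennreal (g y)) \<le> marginal \<mu> f \<theta> y"
    proof (cases "0 < g y")
      case True
      then have "ennreal (g y) * (marginal \<mu> f \<theta> y / ennreal (g y)) = marginal \<mu> f \<theta> y"
        by (simp add: ennreal_times_divide mult.commute[of "ennreal (g y)"] mult_divide_eq_ennreal)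
      then show ?thesis by simp
    qed (simp add: ennreal_neg)
  qed
  also have "\<dots> = 1" by (rule nn_integral_marginal[OF assms])
  finally show ?thesis by (simp add: le_less_trans)
qed

text \<open>
  Only a parameter with finite divergence needs an argument.  There the marginal is almost everywhere
  positive and finite at the observed \<open>Y j\<close>, the conditional density has mean one under importance
  sampling, and \<open>mc_marginal / marginal\<close> is the Monte Carlo estimate of that mean; it is therefore
  uniformly close to one.
\<close>

lemma AE_limsup_KL_mc_le:
  assumes \<theta>: "\<theta> \<in> \<Theta>"
    and GC: "glivenko_cantelli M X P ((\<lambda>y x. conditional \<mu> f \<theta> x y / h x) ` space \<nu>)"
  shows "AE \<omega> in M. \<forall>m n. filterlim m at_top sequentially \<longrightarrow> filterlim n at_top sequentially \<longrightarrow>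
    limsup (\<lambda>k. KL_mc h g f (\<lambda>i. X i \<omega>) (\<lambda>j. Y j \<omega>) (m k) (n k) \<theta>) \<le> KL \<mu> Q g f \<theta>"
proof (cases "KL \<mu> Q g f \<theta> < \<infinity>")
  case True
  note marginal_measurable[OF \<theta>, measurable]
  define u where "u y = ext_ln (ennreal (g y) / marginal \<mu> f \<theta> y)" for y
  define F where "F y = enn2real (marginal \<mu> f \<theta> y)" for y
  have [measurable]: "u \<in> borel_measurable Q" unfolding u_def by measurable
  have KL_u: "KL \<mu> Q g f \<theta> = ext_expectation Q u" unfolding KL_def u_def ..
  have "(\<integral>\<^sup>+y. e2ennreal (- u y) \<partial>Q) < \<infinity>" unfolding u_def by (rule KL_negative_part_finite[OF \<theta>])
  from ext_expectation_finite[OF _ True[unfolded KL_u] this]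
  have fin: "AE y in Q. \<bar>u y\<bar> \<noteq> \<infinity>" and int: "integrable Q (\<lambda>y. real_of_ereal (u y))"
    and KL: "KL \<mu> Q g f \<theta> = ereal (\<integral>y. real_of_ereal (u y) \<partial>Q)" by (simp_all add: KL_u)
  have good: "0 < F y \<and> marginal \<mu> f \<theta> y = ennreal (F y) \<and> real_of_ereal (u y) = ln (g y / F y)"
    if "0 < g y" "\<bar>u y\<bar> \<noteq> \<infinity>" for y
  proof (cases "marginal \<mu> f \<theta> y")
    case (real r)
    have "r \<noteq> 0" using that real by (auto simp: u_def ext_ln_def ennreal_divide_eq_top_iff)
    then have r: "0 < r" using real by simp
    have "F y = r" using real by (simp add: F_def)
    moreover have "real_of_ereal (u y) = ln (g y / r)"
      using r that(1) unfolding u_def real by (simp add: divide_ennreal ext_ln_ennreal)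
    ultimately show ?thesis using r real by simp
  next
    case top
    then show ?thesis using that by (simp add: u_def ext_ln_def)
  qed
  have mean_1: "(\<integral>x. conditional \<mu> f \<theta> x y / h x \<partial>P) = 1"
    if y: "y \<in> space \<nu>" and F: "0 < F y" "marginal \<mu> f \<theta> y = ennreal (F y)" for y
  proof -
    note f_section_measurable[OF \<theta> y, measurable]
    have "(\<integral>x. conditional \<mu> f \<theta> x y / h x \<partial>P) = enn2real (\<integral>\<^sup>+x. ennreal (f \<theta> x y / h x / F y) \<partial>P)"
      using F(1) unfolding conditional_def F_def[symmetric]
    proof (subst integral_eq_nn_integral)
      show "AE x in P. 0 \<le> f \<theta> x y / F y / h x"
        using AE_h_pos by eventually_elim (use f_nonneg[OF \<theta> _ y] F(1) in auto)
    qed (auto simp: field_simps)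
    also have "(\<integral>\<^sup>+x. ennreal (f \<theta> x y / h x / F y) \<partial>P) = (\<integral>\<^sup>+x. ennreal (f \<theta> x y / h x) / ennreal (F y) \<partial>P)"
    proof (rule nn_integral_cong_AE)
      show "AE x in P. ennreal (f \<theta> x y / h x / F y) = ennreal (f \<theta> x y / h x) / ennreal (F y)"
        using AE_h_pos by eventually_elim (use f_nonneg[OF \<theta> _ y] F(1) in \<open>auto simp: divide_ennreal\<close>)
    qed
    also have "\<dots> = (\<integral>\<^sup>+x. ennreal (f \<theta> x y / h x) \<partial>P) / ennreal (F y)"
      by (rule nn_integral_divide) auto
    also have "\<dots> = 1"
      using F by (simp add: importance[OF \<theta> y] divide_ennreal)
    finally show ?thesis by simp
  qed
  have "AE \<omega> in M. \<forall>j. (Y j \<omega> \<in> space \<nu> \<and> 0 < g (Y j \<omega>)) \<and> \<bar>u (Y j \<omega>)\<bar> \<noteq> \<infinity>"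
    using AE_all_Y[OF AE_conjI[OF AE_g_pos fin]] .
  moreover note glivenko_cantelli_AE_uniform[OF GC]
  moreover note M.strong_law_of_large_numbers[OF Y_iid int]
  ultimately show ?thesis
  proof eventually_elim
    case (elim \<omega>)
    have Y: "Y j \<omega> \<in> space \<nu>" "0 < g (Y j \<omega>)" "0 < F (Y j \<omega>)"
      "marginal \<mu> f \<theta> (Y j \<omega>) = ennreal (F (Y j \<omega>))"
      "real_of_ereal (u (Y j \<omega>)) = ln (g (Y j \<omega>) / F (Y j \<omega>))" for j
    proof -
      note Yj = spec[OF elim(1), of j]
      have p: "Y j \<omega> \<in> space \<nu>" "0 < g (Y j \<omega>)" "\<bar>u (Y j \<omega>)\<bar> \<noteq> \<infinity>"
        by (rule Yj[THEN conjunct1, THEN conjunct1] Yj[THEN conjunct1, THEN conjunct2] Yj[THEN conjunct2])+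
      show "Y j \<omega> \<in> space \<nu>" "0 < g (Y j \<omega>)" "0 < F (Y j \<omega>)"
        "marginal \<mu> f \<theta> (Y j \<omega>) = ennreal (F (Y j \<omega>))"
        "real_of_ereal (u (Y j \<omega>)) = ln (g (Y j \<omega>) / F (Y j \<omega>))"
        using p(1,2) good[OF p(2,3)] by blast+
    qed
    show ?case
    proof (intro allI impI)
      fix m n :: "nat \<Rightarrow> nat"
      assume mn: "filterlim m at_top sequentially" "filterlim n at_top sequentially"
      show "limsup (\<lambda>k. KL_mc h g f (\<lambda>i. X i \<omega>) (\<lambda>j. Y j \<omega>) (m k) (n k) \<theta>) \<le> KL \<mu> Q g f \<theta>"
        unfolding KL
      proof (rule limsup_KL_mc_le[OF _ _ _ _ mn])
        show "0 < g (Y j \<omega>)" "0 < F (Y j \<omega>)" for j by (rule Y)+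
        show "(\<lambda>n. (\<Sum>j<n. ln (g (Y j \<omega>) / F (Y j \<omega>))) / real n) \<longlonglongrightarrow> (\<integral>y. real_of_ereal (u y) \<partial>Q)"
          using elim(3) by (simp only: Y)
        fix \<delta> :: real assume "0 < \<delta>"
        with elim(2) have "\<forall>\<^sub>F m in sequentially. \<forall>y\<in>space \<nu>.
          \<bar>(\<Sum>i<m. conditional \<mu> f \<theta> (X i \<omega>) y / h (X i \<omega>)) / real m - (\<integral>x. conditional \<mu> f \<theta> x y / h x \<partial>P)\<bar> < \<delta>"
          by blast
        then show "\<forall>\<^sub>F m in sequentially. \<forall>j.
          \<bar>mc_marginal h f (\<lambda>i. X i \<omega>) m \<theta> (Y j \<omega>) / F (Y j \<omega>) - 1\<bar> < \<delta>"
        proof eventually_elim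
          case (elim m)
          show ?case
          proof
            fix j
            have "(\<Sum>i<m. conditional \<mu> f \<theta> (X i \<omega>) (Y j \<omega>) / h (X i \<omega>)) / real m =
                mc_marginal h f (\<lambda>i. X i \<omega>) m \<theta> (Y j \<omega>) / F (Y j \<omega>)"
              unfolding mc_marginal_def conditional_def F_def[symmetric]
              by (simp add: sum_divide_distrib mult_ac)
            then show "\<bar>mc_marginal h f (\<lambda>i. X i \<omega>) m \<theta> (Y j \<omega>) / F (Y j \<omega>) - 1\<bar> < \<delta>"
              using elim[rule_format, OF Y(1)[of j]] mean_1[OF Y(1,3,4)[of j]] by simp
          qed
        qed
      qed
    qed
  qed
qed (auto simp: not_less)

section \<open>Suprema of densities over neighbourhoods\<close>

definition envelope :: "'t set \<Rightarrow> 'y \<Rightarrow> ennreal" where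
  "envelope V y = (\<integral>\<^sup>+ x. sup_density f V x y / ennreal (h x * g y) \<partial>P)"

lemma envelope_mono: "V \<subseteq> U \<Longrightarrow> envelope V y \<le> envelope U y"
  unfolding envelope_def sup_density_def
  by (intro nn_integral_mono divide_right_mono_ennreal SUP_subset_mono) auto

text \<open>
  The properties inherited by every sufficiently small neighbourhood with measurable supremum, and
  sufficient for the lower bound on it.  The last one says that the positive part of
  \<open>ln (envelope V)\<close> has a finite integral; it is stated by the positive part alone because in this
  form it visibly passes to subsets.
\<close>

definition regular :: "'t set \<Rightarrow> bool" where
  "regular V \<longleftrightarrow> V \<noteq> {} \<and> V \<subseteq> \<Theta> \<and>
    (\<lambda>(x, y). sup_density f V x y) \<in> borel_measurable (\<mu> \<Otimes>\<^sub>M \<nu>) \<and>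
    (\<forall>x\<in>space \<mu>. \<forall>y\<in>space \<nu>. 0 < h x \<longrightarrow> 0 < g y \<longrightarrow> bdd_above ((\<lambda>\<phi>. f \<phi> x y) ` V)) \<and>
    glivenko_cantelli M X P (sup_ratio h g f V ` space \<nu>) \<and>
    (\<integral>\<^sup>+y. e2ennreal (ext_ln (envelope V y)) \<partial>Q) < \<infinity>"

lemma sup_density_section_measurable:
  assumes "regular V" "y \<in> space \<nu>"
  shows "(\<lambda>x. sup_density f V x y) \<in> borel_measurable \<mu>"
proof -
  have "(\<lambda>(x, y). sup_density f V x y) \<in> borel_measurable (\<mu> \<Otimes>\<^sub>M \<nu>)"
    using assms(1) unfolding regular_def by blast
  from measurable_Pair2[OF measurable_compose[OF measurable_pair_swap' this] assms(2)]
  show ?thesis by simp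
qed

lemma envelope_measurable:
  assumes "regular V"
  shows "envelope V \<in> borel_measurable \<nu>"
proof -
  have "(\<lambda>(x, y). sup_density f V x y) \<in> borel_measurable (\<mu> \<Otimes>\<^sub>M \<nu>)"
    using assms unfolding regular_def by blast
  from measurable_compose[OF measurable_pair_swap' this]
  have [measurable]: "(\<lambda>(y, x). sup_density f V x y) \<in> borel_measurable (\<nu> \<Otimes>\<^sub>M \<mu>)"
    by (simp add: case_prod_beta')
  show ?thesis unfolding envelope_def[abs_def] by measurable
qed

text \<open>
  Links the real-valued supremum, about which the Glivenko-Cantelli hypothesis speaks, with the
  extended one, which can be integrated without a boundedness assumption.
\<close>

lemma sup_ratio_eq_sup_density:
  assumes V: "regular V" and y: "y \<in> space \<nu>" "0 < g y" and x: "x \<in> space \<mu>" "0 < h x"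
  shows "0 \<le> sup_ratio h g f V y x"
    and "sup_density f V x y / ennreal (h x * g y) = ennreal (sup_ratio h g f V y x)"
proof -
  have ne: "V \<noteq> {}" and sub: "V \<subseteq> \<Theta>" and bdd: "bdd_above ((\<lambda>\<phi>. f \<phi> x y) ` V)"
    using V y x unfolding regular_def by auto
  obtain \<phi> where \<phi>: "\<phi> \<in> V" using ne by blast
  have "0 \<le> f \<phi> x y" using f_nonneg \<phi> sub x(1) y(1) by blast
  also have "\<dots> \<le> (SUP \<phi>\<in>V. f \<phi> x y)" by (rule cSUP_upper[OF \<phi> bdd])
  finally have *: "0 \<le> (SUP \<phi>\<in>V. f \<phi> x y)" .
  then show "0 \<le> sup_ratio h g f V y x" using x(2) y(2) by (simp add: sup_ratio_def)
  show "sup_density f V x y / ennreal (h x * g y) = ennreal (sup_ratio h g f V y x)"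
    using * x(2) y(2) unfolding sup_density_def sup_ratio_def ennreal_cSUP[OF ne bdd, symmetric]
    by (intro divide_ennreal) auto
qed

lemma
  assumes V: "regular V" and y: "y \<in> space \<nu>" "0 < g y"
  shows envelope_finite: "envelope V y = ennreal (enn2real (envelope V y))"
    and integral_sup_ratio: "(\<integral>x. sup_ratio h g f V y x \<partial>P) = enn2real (envelope V y)"
proof -
  have int: "integrable P (sup_ratio h g f V y)"
    using V y unfolding regular_def glivenko_cantelli_def by auto
  have nonneg: "AE x in P. 0 \<le> sup_ratio h g f V y x"
    using AE_h_pos by eventually_elim (use sup_ratio_eq_sup_density(1)[OF V y] in auto)
  have "envelope V y = (\<integral>\<^sup>+x. ennreal (sup_ratio h g f V y x) \<partial>P)"
    unfolding envelope_def
    by (rule nn_integral_cong_AE)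
      (use AE_h_pos in eventually_elim, use sup_ratio_eq_sup_density(2)[OF V y] in auto)
  also have "\<dots> = ennreal (\<integral>x. sup_ratio h g f V y x \<partial>P)"
    by (rule nn_integral_eq_integral[OF int nonneg])
  finally show "envelope V y = ennreal (enn2real (envelope V y))"
    "(\<integral>x. sup_ratio h g f V y x \<partial>P) = enn2real (envelope V y)"
    using integral_nonneg_AE[OF nonneg] by simp_all
qed

text \<open>
  Bounded below by \<open>ln e\<close>, and above because \<open>e + s \<le> (1 + e) * max 1 s\<close>.
\<close>

lemma integrable_ln_envelope:
  assumes V: "regular V" and e: "0 < e"
  shows "integrable Q (\<lambda>y. ln (e + enn2real (envelope V y)))"
proof (rule integrableI_bounded)
  note envelope_measurable[OF V, measurable]
  show "(\<lambda>y. ln (e + enn2real (envelope V y))) \<in> borel_measurable Q" by measurable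
  have "(\<integral>\<^sup>+y. ennreal (norm (ln (e + enn2real (envelope V y)))) \<partial>Q)
      \<le> (\<integral>\<^sup>+y. ennreal (\<bar>ln e\<bar> + \<bar>ln (1 + e)\<bar>) + e2ennreal (ext_ln (envelope V y)) \<partial>Q)"
  proof (rule nn_integral_mono_AE)
    show "AE y in Q. ennreal (norm (ln (e + enn2real (envelope V y))))
        \<le> ennreal (\<bar>ln e\<bar> + \<bar>ln (1 + e)\<bar>) + e2ennreal (ext_ln (envelope V y))"
      using AE_g_pos
    proof eventually_elim
      case (elim y)
      define s where "s = enn2real (envelope V y)"
      have s: "0 \<le> s" "envelope V y = ennreal s"
        using envelope_finite[OF V, of y] elim by (auto simp: s_def)
      have lo: "ln e \<le> ln (e + s)" using e s(1) by simp
      show ?case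
      proof (cases "s \<le> 1")
        case True
        have "ln (e + s) \<le> ln (1 + e)" using e s(1) True by simp
        then have "\<bar>ln (e + s)\<bar> \<le> \<bar>ln e\<bar> + \<bar>ln (1 + e)\<bar>" using lo by linarith
        then have "ennreal \<bar>ln (e + s)\<bar> \<le> ennreal (\<bar>ln e\<bar> + \<bar>ln (1 + e)\<bar>)" by (rule ennreal_leI)
        then show ?thesis unfolding s_def by (simp add: add_increasing2)
      next
        case False
        then have "1 < s" by simp
        have "e + s \<le> (1 + e) * s" using \<open>1 < s\<close> e by (simp add: algebra_simps)
        then have "ln (e + s) \<le> ln ((1 + e) * s)" using e s(1) \<open>1 < s\<close> by (intro ln_mono) auto
        also have "\<dots> = ln (1 + e) + ln s" using e \<open>1 < s\<close> by (simp add: ln_mult)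
        finally have "\<bar>ln (e + s)\<bar> \<le> (\<bar>ln e\<bar> + \<bar>ln (1 + e)\<bar>) + ln s"
          using lo ln_gt_zero[OF \<open>1 < s\<close>] by linarith
        then have "ennreal \<bar>ln (e + s)\<bar> \<le> ennreal ((\<bar>ln e\<bar> + \<bar>ln (1 + e)\<bar>) + ln s)"
          by (rule ennreal_leI)
        also have "\<dots> = ennreal (\<bar>ln e\<bar> + \<bar>ln (1 + e)\<bar>) + ennreal (ln s)"
          using ln_gt_zero[OF \<open>1 < s\<close>] by (intro ennreal_plus) auto
        also have "ennreal (ln s) = e2ennreal (ext_ln (envelope V y))"
          using \<open>1 < s\<close> unfolding s(2) by (subst ext_ln_ennreal) auto
        finally show ?thesis unfolding s_def by simp
      qed
    qed
  qed
  also have "\<dots> = ennreal (\<bar>ln e\<bar> + \<bar>ln (1 + e)\<bar>) + (\<integral>\<^sup>+y. e2ennreal (ext_ln (envelope V y)) \<partial>Q)"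
    by (subst nn_integral_add) (auto simp: Q.emeasure_space_1)
  also have "\<dots> < \<infinity>" using V unfolding regular_def by simp
  finally show "(\<integral>\<^sup>+y. ennreal (norm (ln (e + enn2real (envelope V y)))) \<partial>Q) < \<infinity>" .
qed

lemma AE_le_liminf_INF_KL_mc:
  assumes V: "regular V" and e: "0 < e"
  shows "AE \<omega> in M. \<forall>m n. filterlim m at_top sequentially \<longrightarrow> filterlim n at_top sequentially \<longrightarrow>
    ereal (- (\<integral>y. ln (e + enn2real (envelope V y)) \<partial>Q)) \<le>
    liminf (\<lambda>k. INF \<phi>\<in>V. KL_mc h g f (\<lambda>i. X i \<omega>) (\<lambda>j. Y j \<omega>) (m k) (n k) \<phi>)"
proof -
  have GC: "glivenko_cantelli M X P (sup_ratio h g f V ` space \<nu>)"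
    using V unfolding regular_def by blast
  note glivenko_cantelli_AE_uniform[OF GC] AE_all_X[OF AE_h_pos] AE_all_Y[OF AE_g_pos]
    M.strong_law_of_large_numbers[OF Y_iid integrable_ln_envelope[OF V e]]
  then show ?thesis
  proof eventually_elim
    case (elim \<omega>)
    show ?case
    proof (intro allI impI)
      fix m n :: "nat \<Rightarrow> nat"
      assume mn: "filterlim m at_top sequentially" "filterlim n at_top sequentially"
      show "ereal (- (\<integral>y. ln (e + enn2real (envelope V y)) \<partial>Q)) \<le>
        liminf (\<lambda>k. INF \<phi>\<in>V. KL_mc h g f (\<lambda>i. X i \<omega>) (\<lambda>j. Y j \<omega>) (m k) (n k) \<phi>)"
      proof (rule le_liminf_INF_KL_mc[where s = "\<lambda>y. enn2real (envelope V y)" and ys = "\<lambda>j. Y j \<omega>",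
            OF _ _ _ _ e _ _ elim(4) mn])
        show "0 < g (Y j \<omega>)" "0 < h (X i \<omega>)" for i j using elim by auto
        show "bdd_above ((\<lambda>\<phi>. f \<phi> (X i \<omega>) (Y j \<omega>)) ` V)" for i j
          using V elim unfolding regular_def by auto
        show "0 \<le> f \<phi> (X i \<omega>) (Y j \<omega>)" if "\<phi> \<in> V" for \<phi> i j
          using V elim that f_nonneg unfolding regular_def by blast
        note Y_good = elim(3)
        have "\<forall>\<^sub>F m in sequentially. \<forall>y\<in>space \<nu>.
            \<bar>(\<Sum>i<m. sup_ratio h g f V y (X i \<omega>)) / real m - (\<integral>x. sup_ratio h g f V y x \<partial>P)\<bar> < e"
          using elim(1) e by blast
        then show "\<forall>\<^sub>F m in sequentially. \<forall>j.
            \<bar>(\<Sum>i<m. sup_ratio h g f V (Y j \<omega>) (X i \<omega>)) / real m - enn2real (envelope V (Y j \<omega>))\<bar> < e"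
        proof eventually_elim
          case (elim m)
          show ?case
          proof
            fix j
            have Yj: "Y j \<omega> \<in> space \<nu>" "0 < g (Y j \<omega>)" using Y_good by auto
            show "\<bar>(\<Sum>i<m. sup_ratio h g f V (Y j \<omega>) (X i \<omega>)) / real m - enn2real (envelope V (Y j \<omega>))\<bar> < e"
              using elim Yj(1) unfolding integral_sup_ratio[OF V Yj, symmetric] by blast
          qed
        qed
      qed simp
    qed
  qed
qed

text \<open>
  By upper semicontinuity the suprema of the densities over neighbourhoods shrinking to \<open>\<theta>\<close> converge
  to the density at \<open>\<theta>\<close>.  Dominated convergence, with the supremum over \<open>U\<close> as dominating function,
  takes this under the integral over \<open>x\<close>, where the importance sampling identity recovers the
  marginal; the integral over \<open>y\<close> of the logarithm is then handled by Fatou's lemma.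
\<close>

lemma KL_le_of_shrinking:
  assumes \<theta>: "\<theta> \<in> \<Theta>" "\<And>k. \<theta> \<in> V k" and U: "regular U" and V: "\<And>k. regular (V k)" "\<And>k. V k \<subseteq> U"
    and T: "topspace T = \<Theta>"
    and shrink: "\<And>W. openin T W \<Longrightarrow> \<theta> \<in> W \<Longrightarrow> \<forall>\<^sub>F k in sequentially. V k \<subseteq> W"
    and usc: "\<And>x y. x \<in> space \<mu> \<Longrightarrow> y \<in> space \<nu> \<Longrightarrow> usc_map T (\<lambda>\<theta>. f \<theta> x y)"
    and c: "\<And>k. - (\<integral>y. ln (1 / real (Suc k) + enn2real (envelope (V k) y)) \<partial>Q) \<le> c"
  shows "KL \<mu> Q g f \<theta> \<le> ereal c"
proof -
  note [measurable] = envelope_measurable[OF V(1)] marginal_measurable[OF \<theta>(1)]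
  define \<phi> where "\<phi> y = marginal \<mu> f \<theta> y / ennreal (g y)" for y
  have [measurable]: "\<phi> \<in> borel_measurable Q" unfolding \<phi>_def by measurable
  have sup_tendsto: "(\<lambda>k. sup_density f (V k) x y) \<longlonglongrightarrow> ennreal (f \<theta> x y)"
    if x: "x \<in> space \<mu>" and y: "y \<in> space \<nu>" for x y
  proof (rule order_tendstoI)
    fix a assume "a < ennreal (f \<theta> x y)"
    moreover have "ennreal (f \<theta> x y) \<le> sup_density f (V k) x y" for k
      unfolding sup_density_def using \<theta>(2) by (rule SUP_upper)
    ultimately show "\<forall>\<^sub>F k in sequentially. a < sup_density f (V k) x y"
      by (intro always_eventually allI) (rule less_le_trans)
  next
    fix a assume a: "ennreal (f \<theta> x y) < a"
    then obtain b where b: "ennreal (f \<theta> x y) < b" "b < a" using dense by blast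
    then obtain r where r: "0 \<le> r" "b = ennreal r"
      using less_le_trans[OF b(2) top_greatest] by (cases b) auto
    have "f \<theta> x y < r" using b(1) r f_nonneg[OF \<theta>(1) x y] by (simp add: ennreal_less_iff)
    have "openin T {\<phi> \<in> topspace T. f \<phi> x y < r}"
      using usc[OF x y] unfolding usc_map_def by blast
    then have "\<forall>\<^sub>F k in sequentially. V k \<subseteq> {\<phi> \<in> topspace T. f \<phi> x y < r}"
      by (rule shrink) (use \<theta>(1) T \<open>f \<theta> x y < r\<close> in auto)
    then show "\<forall>\<^sub>F k in sequentially. sup_density f (V k) x y < a"
    proof eventually_elim
      case (elim k)
      have "sup_density f (V k) x y \<le> ennreal r"
        unfolding sup_density_def using elim by (intro SUP_least ennreal_leI) auto
      then show ?case using b(2) r(2) by simp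
    qed
  qed
  have envelope_tendsto: "(\<lambda>k. envelope (V k) y) \<longlonglongrightarrow> \<phi> y" if y: "y \<in> space \<nu>" "0 < g y" for y
  proof -
    note [measurable] = sup_density_section_measurable[OF V(1) y(1)]
      sup_density_section_measurable[OF U y(1)] f_section_measurable[OF \<theta>(1) y(1)]
    have "(\<lambda>k. envelope (V k) y) \<longlonglongrightarrow> (\<integral>\<^sup>+x. ennreal (f \<theta> x y) / ennreal (h x * g y) \<partial>P)"
      unfolding envelope_def
    proof (rule nn_integral_dominated_convergence)
      show "(\<integral>\<^sup>+x. sup_density f U x y / ennreal (h x * g y) \<partial>P) < \<infinity>"
        using envelope_finite[OF U y] unfolding envelope_def[symmetric]
        by (metis ennreal_less_top infinity_ennreal_def)
      show "AE x in P. sup_density f (V k) x y / ennreal (h x * g y) \<le> sup_density f U x y / ennreal (h x * g y)" for k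
        using V(2) unfolding sup_density_def
        by (intro AE_I2 divide_right_mono_ennreal SUP_subset_mono) auto
      show "AE x in P. (\<lambda>k. sup_density f (V k) x y / ennreal (h x * g y)) \<longlonglongrightarrow> ennreal (f \<theta> x y) / ennreal (h x * g y)"
        using AE_h_pos
      proof eventually_elim
        case (elim x)
        then have "h x * g y > 0" using y(2) by simp
        then have "inverse (ennreal (h x * g y)) < top" by (simp add: inverse_ennreal)
        then have "(\<lambda>k. inverse (ennreal (h x * g y)) * sup_density f (V k) x y)
            \<longlonglongrightarrow> inverse (ennreal (h x * g y)) * ennreal (f \<theta> x y)"
          using elim by (intro ennreal_tendsto_cmult sup_tendsto y(1)) auto
        then show ?case by (simp only: divide_ennreal_def mult.commute)
      qed
    qed auto
    also have "(\<integral>\<^sup>+x. ennreal (f \<theta> x y) / ennreal (h x * g y) \<partial>P) = (\<integral>\<^sup>+x. ennreal (f \<theta> x y / h x) / ennreal (g y) \<partial>P)"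
    proof (rule nn_integral_cong_AE)
      show "AE x in P. ennreal (f \<theta> x y) / ennreal (h x * g y) = ennreal (f \<theta> x y / h x) / ennreal (g y)"
        using AE_h_pos
      proof eventually_elim
        case (elim x)
        then show ?case
          using y f_nonneg[OF \<theta>(1) _ y(1), of x] by (simp add: divide_ennreal)
      qed
    qed
    also have "\<dots> = (\<integral>\<^sup>+x. ennreal (f \<theta> x y / h x) \<partial>P) / ennreal (g y)"
      by (rule nn_integral_divide) auto
    also have "\<dots> = \<phi> y" by (simp add: importance[OF \<theta>(1) y(1)] \<phi>_def)
    finally show ?thesis .
  qed
  have "ext_expectation Q (\<lambda>y. - ext_ln (\<phi> y)) \<le> ereal c"
  proof (rule ext_expectation_uminus_ext_ln_le[where s = "\<lambda>k y. enn2real (envelope (V k) y)"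
        and t = "\<lambda>y. enn2real (envelope U y)"])
    show "prob_space Q" by (rule Q)
    show "AE y in Q. \<forall>k. enn2real (envelope (V k) y) \<le> enn2real (envelope U y)"
      using AE_g_pos
    proof eventually_elim
      case (elim y)
      then have "envelope U y < top"
        using envelope_finite[OF U, of y] by (metis ennreal_less_top)
      then show ?case using envelope_mono[OF V(2)] by (intro allI enn2real_mono) auto
    qed
    show "integrable Q (\<lambda>y. ln (1 + enn2real (envelope U y)))"
      by (rule integrable_ln_envelope[OF U]) simp
    show "AE y in Q. (\<lambda>k. ennreal (enn2real (envelope (V k) y))) \<longlonglongrightarrow> \<phi> y"
      using AE_g_pos
    proof eventually_elim
      case (elim y)
      then show ?case using envelope_tendsto[of y] envelope_finite[OF V(1), of y] by simp
    qed
    show "- (\<integral>y. ln (1 / real (Suc k) + enn2real (envelope (V k) y)) \<partial>Q) \<le> c" for k by (rule c)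
  qed auto
  also have "ext_expectation Q (\<lambda>y. - ext_ln (\<phi> y)) = KL \<mu> Q g f \<theta>"
  proof -
    have eq: "AE y in Q. ext_ln (ennreal (g y) / marginal \<mu> f \<theta> y) = - ext_ln (\<phi> y)"
      using AE_g_pos by eventually_elim (simp add: \<phi>_def ext_ln_divide_swap)
    have "(\<integral>\<^sup>+ y. e2ennreal (ext_ln (ennreal (g y) / marginal \<mu> f \<theta> y)) \<partial>Q)
        = (\<integral>\<^sup>+ y. e2ennreal (- ext_ln (\<phi> y)) \<partial>Q)"
      "(\<integral>\<^sup>+ y. e2ennreal (- ext_ln (ennreal (g y) / marginal \<mu> f \<theta> y)) \<partial>Q)
        = (\<integral>\<^sup>+ y. e2ennreal (- (- ext_ln (\<phi> y))) \<partial>Q)"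
      using eq by (auto intro!: nn_integral_cong_AE)
    then show ?thesis unfolding KL_def ext_expectation_def by simp
  qed
  finally show ?thesis .
qed

end

section \<open>Epi-convergence\<close>

theorem theorem2p2:
  fixes \<Theta> :: "(real ^ 'd) set" and T :: "(real ^ 'd) topology"
    and \<mu> P :: "'x measure" and \<nu> Q :: "'y measure" and M :: "'w measure"
    and f :: "real ^ 'd \<Rightarrow> 'x \<Rightarrow> 'y \<Rightarrow> real" and h :: "'x \<Rightarrow> real" and g :: "'y \<Rightarrow> real"
    and X :: "nat \<Rightarrow> 'w \<Rightarrow> 'x" and Y :: "nat \<Rightarrow> 'w \<Rightarrow> 'y"
  assumes sigma_finite: "sigma_finite_measure \<mu>" "sigma_finite_measure \<nu>"
    and f_meas: "\<And>\<theta>. \<theta> \<in> \<Theta> \<Longrightarrow> (\<lambda>(x, y). f \<theta> x y) \<in> borel_measurable (\<mu> \<Otimes>\<^sub>M \<nu>)"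
    and f_nonneg: "\<And>\<theta> x y. \<theta> \<in> \<Theta> \<Longrightarrow> x \<in> space \<mu> \<Longrightarrow> y \<in> space \<nu> \<Longrightarrow> 0 \<le> f \<theta> x y"
    and f_density: "\<And>\<theta>. \<theta> \<in> \<Theta> \<Longrightarrow> (\<integral>\<^sup>+ (x, y). ennreal (f \<theta> x y) \<partial>(\<mu> \<Otimes>\<^sub>M \<nu>)) = 1"
    and P: "prob_space P" "P = density \<mu> (\<lambda>x. ennreal (h x))"
    and h: "h \<in> borel_measurable \<mu>" "\<And>x. x \<in> space \<mu> \<Longrightarrow> 0 \<le> h x"
    and Q: "prob_space Q" "Q = density \<nu> (\<lambda>y. ennreal (g y))"
    and g: "g \<in> borel_measurable \<nu>" "\<And>y. y \<in> space \<nu> \<Longrightarrow> 0 \<le> g y"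
    and M: "prob_space M"
    and X_iid: "prob_space.indep_vars M (\<lambda>_. \<mu>) X UNIV" "\<And>i. distr M \<mu> (X i) = P"
    and Y_iid: "prob_space.indep_vars M (\<lambda>_. \<nu>) Y UNIV" "\<And>j. distr M \<nu> (Y j) = Q"
    and XY_indep: "prob_space.indep_set M
          (sets (vimage_algebra (space M) (\<lambda>\<omega> i. X i \<omega>) (PiM UNIV (\<lambda>_. \<mu>))))
          (sets (vimage_algebra (space M) (\<lambda>\<omega> j. Y j \<omega>) (PiM UNIV (\<lambda>_. \<nu>))))"
    and importance: "\<And>\<theta> y. \<theta> \<in> \<Theta> \<Longrightarrow> y \<in> space \<nu> \<Longrightarrow>
          (\<integral>\<^sup>+ x. ennreal (f \<theta> x y / h x) \<partial>P) = marginal \<mu> f \<theta> y"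
    and KL_finite: "\<exists>\<theta>\<in>\<Theta>. KL \<mu> Q g f \<theta> < \<infinity>"
    and sup_meas: "neighbourhood_base_of
          (\<lambda>V. (\<lambda>(x, y). sup_density f V x y) \<in> borel_measurable (\<mu> \<Otimes>\<^sub>M \<nu>)) T"
    and hyp1: "topspace T = \<Theta>" "second_countable T"
    and hyp2: "\<And>x y. x \<in> space \<mu> \<Longrightarrow> y \<in> space \<nu> \<Longrightarrow> usc_map T (\<lambda>\<theta>. f \<theta> x y)"
    and hyp3: "\<And>\<theta>. \<theta> \<in> \<Theta> \<Longrightarrow> \<exists>B\<^sub>\<theta> \<in> nbhds_of T \<theta>.
          ext_expectation Q (\<lambda>y. ext_ln (\<integral>\<^sup>+ x. sup_density f B\<^sub>\<theta> x y / ennreal (h x * g y) \<partial>P)) < \<infinity>"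
    and hyp4: "\<And>\<theta>. \<theta> \<in> \<Theta> \<Longrightarrow> \<exists>C\<^sub>\<theta> \<in> nbhds_of T \<theta>.
          (\<forall>x\<in>space \<mu>. \<forall>y\<in>space \<nu>. 0 < h x \<longrightarrow> 0 < g y \<longrightarrow> bdd_above ((\<lambda>\<phi>. f \<phi> x y) ` C\<^sub>\<theta>)) \<and>
          (\<forall>B. B \<subseteq> C\<^sub>\<theta> \<longrightarrow> B \<noteq> {} \<longrightarrow> glivenko_cantelli M X P (sup_ratio h g f B ` space \<nu>))"
    and hyp5: "\<And>\<theta>. \<theta> \<in> \<Theta> \<Longrightarrow>
          glivenko_cantelli M X P ((\<lambda>y x. conditional \<mu> f \<theta> x y / h x) ` space \<nu>)"
  shows "AE \<omega> in M. epi_converges T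
           (KL_mc h g f (\<lambda>i. X i \<omega>) (\<lambda>j. Y j \<omega>)) (KL \<mu> Q g f)"
proof -
  interpret importance_sampling \<Theta> \<mu> P \<nu> Q M f h g X Y
  proof (rule importance_sampling.intro)
    show "sigma_finite_measure \<mu>" "sigma_finite_measure \<nu>" by (rule sigma_finite)+
    show "X i \<in> measurable M \<mu>" for i
      using X_iid(1) unfolding prob_space.indep_vars_def[OF M] by auto
  qed (fact f_meas f_nonneg f_density P h Q g M X_iid Y_iid importance)+
  obtain D where D: "countable D" "D \<subseteq> topspace T"
    "\<And>U \<theta>. openin T U \<Longrightarrow> \<theta> \<in> U \<Longrightarrow> (INF \<phi>\<in>D \<inter> U. KL \<mu> Q g f \<phi>) \<le> KL \<mu> Q g f \<theta>"
    by (rule countable_INF_dense[OF hyp1(2), of "KL \<mu> Q g f"], rule that)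
  obtain \<V> where \<V>: "countable \<V>"
    "\<And>V. V \<in> \<V> \<Longrightarrow> (\<lambda>(x, y). sup_density f V x y) \<in> borel_measurable (\<mu> \<Otimes>\<^sub>M \<nu>)"
    "\<And>U \<theta>. U \<in> nbhds_of T \<theta> \<Longrightarrow> \<exists>V\<in>\<V>. V \<in> nbhds_of T \<theta> \<and> V \<subseteq> U"
    by (rule countable_neighbourhood_family[OF hyp1(2) sup_meas]) blast
  define \<V>' where "\<V>' = {V \<in> \<V>. regular V}"
  have "countable \<V>'" unfolding \<V>'_def using \<V>(1) by simp
  have \<V>': "\<exists>V\<in>\<V>'. V \<in> nbhds_of T \<theta> \<and> V \<subseteq> U" if U: "U \<in> nbhds_of T \<theta>" for U \<theta>
  proof -
    have \<theta>: "\<theta> \<in> \<Theta>" using U hyp1(1) unfolding nbhds_of_def by blast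
    obtain B where B: "B \<in> nbhds_of T \<theta>" "ext_expectation Q (\<lambda>y. ext_ln (envelope B y)) < \<infinity>"
      using hyp3[OF \<theta>] unfolding envelope_def by blast
    obtain C where C: "C \<in> nbhds_of T \<theta>"
      "\<forall>x\<in>space \<mu>. \<forall>y\<in>space \<nu>. 0 < h x \<longrightarrow> 0 < g y \<longrightarrow> bdd_above ((\<lambda>\<phi>. f \<phi> x y) ` C)"
      "\<And>B. B \<subseteq> C \<Longrightarrow> B \<noteq> {} \<Longrightarrow> glivenko_cantelli M X P (sup_ratio h g f B ` space \<nu>)"
      using hyp4[OF \<theta>] by blast
    obtain V where V: "V \<in> \<V>" "V \<in> nbhds_of T \<theta>" "V \<subseteq> U \<inter> (B \<inter> C)"
      using \<V>(3)[OF nbhds_of_Int[OF U nbhds_of_Int[OF B(1) C(1)]]] by blast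
    have ne: "V \<noteq> {}" using nbhds_of_memD[OF V(2)] by blast
    have "regular V" unfolding regular_def
    proof (intro conjI ne \<V>(2) V(1) C(3))
      show "V \<subseteq> \<Theta>" using V(2) hyp1(1) unfolding nbhds_of_def by blast
      show "V \<subseteq> C" using V(3) by blast
      show "\<forall>x\<in>space \<mu>. \<forall>y\<in>space \<nu>. 0 < h x \<longrightarrow> 0 < g y \<longrightarrow> bdd_above ((\<lambda>\<phi>. f \<phi> x y) ` V)"
        using C(2) \<open>V \<subseteq> C\<close> by (meson bdd_above_mono image_mono)
      have "(\<integral>\<^sup>+y. e2ennreal (ext_ln (envelope V y)) \<partial>Q) \<le> (\<integral>\<^sup>+y. e2ennreal (ext_ln (envelope B y)) \<partial>Q)"
        using V(3) by (intro nn_integral_mono e2ennreal_mono ext_ln_mono envelope_mono) auto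
      also have "\<dots> < \<infinity>" by (rule ext_expectation_less_topD[OF B(2)])
      finally show "(\<integral>\<^sup>+y. e2ennreal (ext_ln (envelope V y)) \<partial>Q) < \<infinity>" .
    qed
    then show ?thesis using V unfolding \<V>'_def by blast
  qed
  \<comment> \<open>the two exceptional null sets are collected over countable families before \<open>\<theta>\<close>, \<open>m\<close>, \<open>n\<close> are chosen\<close>
  have upper: "AE \<omega> in M. \<forall>\<theta>\<in>D. \<forall>m n. filterlim m at_top sequentially \<longrightarrow> filterlim n at_top sequentially \<longrightarrow>
      limsup (\<lambda>k. KL_mc h g f (\<lambda>i. X i \<omega>) (\<lambda>j. Y j \<omega>) (m k) (n k) \<theta>) \<le> KL \<mu> Q g f \<theta>"
    unfolding AE_ball_countable[OF D(1)]
    by (intro ballI AE_limsup_KL_mc_le hyp5) (use D(2) hyp1(1) in auto)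
  have lower: "AE \<omega> in M. \<forall>V\<in>\<V>'. \<forall>k. \<forall>m n. filterlim m at_top sequentially \<longrightarrow> filterlim n at_top sequentially \<longrightarrow>
      ereal (- (\<integral>y. ln (1 / real (Suc k) + enn2real (envelope V y)) \<partial>Q)) \<le>
      liminf (\<lambda>k. INF \<phi>\<in>V. KL_mc h g f (\<lambda>i. X i \<omega>) (\<lambda>j. Y j \<omega>) (m k) (n k) \<phi>)"
    unfolding AE_ball_countable[OF \<open>countable \<V>'\<close>] AE_all_countable
    by (intro ballI allI AE_le_liminf_INF_KL_mc) (auto simp: \<V>'_def)
  from upper lower show ?thesis
  proof eventually_elim
    case (elim \<omega>)
    show ?case unfolding epi_converges_def
    proof (intro allI impI ballI conjI)
      fix m n :: "nat \<Rightarrow> nat" and \<theta>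
      assume mn: "filterlim m at_top sequentially" "filterlim n at_top sequentially"
        and \<theta>: "\<theta> \<in> topspace T"
      let ?F = "\<lambda>k. KL_mc h g f (\<lambda>i. X i \<omega>) (\<lambda>j. Y j \<omega>) (m k) (n k)"
      show "(SUP B \<in> nbhds_of T \<theta>. limsup (\<lambda>k. INF \<phi> \<in> B. ?F k \<phi>)) \<le> KL \<mu> Q g f \<theta>"
        using elim(1) mn by (intro epi_limsup_le[OF D(3)]) auto
      let ?S = "SUP B \<in> nbhds_of T \<theta>. liminf (\<lambda>k. INF \<phi> \<in> B. ?F k \<phi>)"
      have "topspace T \<in> nbhds_of T \<theta>" using \<theta> unfolding nbhds_of_def by blast
      then obtain U where U: "U \<in> \<V>'" "U \<in> nbhds_of T \<theta>" using \<V>' by blast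
      obtain V :: "nat \<Rightarrow> (real ^ 'd) set"
        where V: "\<And>k. V k \<in> \<V>'" "\<And>k. V k \<in> nbhds_of T \<theta>" "\<And>k. V k \<subseteq> U"
        "\<And>W. openin T W \<Longrightarrow> \<theta> \<in> W \<Longrightarrow> \<forall>\<^sub>F k in sequentially. V k \<subseteq> W"
        by (rule shrinking_neighbourhoods[OF hyp1(2) U(2) \<V>']) blast+
      have S: "ereal (- (\<integral>y. ln (1 / real (Suc k) + enn2real (envelope (V k) y)) \<partial>Q)) \<le> ?S" for k
      proof -
        have "ereal (- (\<integral>y. ln (1 / real (Suc k) + enn2real (envelope (V k) y)) \<partial>Q))
            \<le> liminf (\<lambda>i. INF \<phi>\<in>V k. ?F i \<phi>)"
          using elim(2) V(1) mn by blast
        also have "\<dots> \<le> ?S" using V(2) by (rule SUP_upper)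
        finally show ?thesis .
      qed
      show "KL \<mu> Q g f \<theta> \<le> ?S"
      proof (cases ?S)
        case (real c)
        have "KL \<mu> Q g f \<theta> \<le> ereal c"
        proof (rule KL_le_of_shrinking[of \<theta> V U T])
          show "\<theta> \<in> \<Theta>" using \<theta> hyp1(1) by simp
          show "\<theta> \<in> V k" for k by (rule nbhds_of_memD[OF V(2)])
          show "regular U" "regular (V k)" for k using U(1) V(1) unfolding \<V>'_def by blast+
          show "- (\<integral>y. ln (1 / real (Suc k) + enn2real (envelope (V k) y)) \<partial>Q) \<le> c" for k
            using S[of k] unfolding real by simp
        qed (use V hyp1(1) hyp2 in auto)
        then show ?thesis unfolding real .
      next
        case MInf
        then show ?thesis using S[of 0] by simp
      qed simp
    qed
  qed
qed

end
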